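(* Let $q\in\mathbb{C}$, $0<|q|<1$. Put four metaplectic representations of $U_q(\mathfrak{su}(1,1))$ in $\mathcal{A}_q(4)$, one on each $q$-oscillator, and add them pairwise with the coproduct, which gives two mutually commuting realizations of $U_q(\mathfrak{su}(1,1))$, for $i=1,2$: $$\mathscr{J}_0^{(2i-1,2i)}=\tfrac12(A_{2i-1}^0+A_{2i}^0+1),\qquad \mathscr{J}_\pm^{(2i-1,2i)}=\frac{1}{[2]_{q^{1/2}}}\Big(q^{A_{2i}^0+\frac12}(A_{2i-1}^\pm)^2+(A_{2i}^\pm)^2\Big).$$ Substitute $J_0,J_\pm\mapsto\mathscr{J}_0^{(12)},\mathscr{J}_\pm^{(12)}$ in the first tensor factor and $J_0,J_\pm\mapsto\mathscr{J}_0^{(34)},\mathscr{J}_\pm^{(34)}$ in the second tensor factor of the generators $K_1,K_2,K_3\in U_q(\mathfrak{su}(1,1))^{\otimes2}$ of the special Askey--Wilson algebra, and of $C^{(1)}=C\otimes1$, $C^{(2)}=1\otimes C$; denote the resulting elements of $\mathcal{A}_q(4)$ by $\mathscr{K}_1,\mathscr{K}_2,\mathscr{K}_3,\mathscr{C}^{(1)},\mathscr{C}^{(2)}$. Then, with $M_\pm,L,H,\mathscr{L}_{12},\mathscr{L}_{34}$ the elements of $\mathcal{A}_q(4)$ realizing the $q$-Higgs algebra, \begin{align*} \mathscr{K}_1&=\frac14\,\frac{1-q^{\frac12L}}{1-q},\\ \mathscr{K}_2&=\frac12\Delta^{(3)}(C)=\frac12\Big(\big(\mathscr{C}^{(1)}q^{\frac12H}+\mathscr{C}^{(2)}q^{-\frac12H}\big)q^{-\frac12L}+(1+q^{-2})\,q^{-\frac12L}\big[\tfrac{L+H}{4}\big]_q\big[\tfrac{L-H}{4}\big]_q\\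 &\qquad\qquad\qquad\quad+\frac{q}{(1+q)^2}\big(q^{-1}M_++qM_-\big)q^{-\frac12(H+L)}\Big),\\ \mathscr{K}_3&=\frac{1}{8(1+q)}\big(M_+-M_-\big)q^{-\frac12H}, \end{align*} where $\Delta^{(3)}(C)$ stands for its image in the four metaplectic representations, and $$M_\pm=([2]_{q^{1/2}})^2\mathscr{J}_\pm^{(12)}\mathscr{J}_\mp^{(34)},\qquad \tfrac12L=\mathscr{J}_0^{(12)}-\mathscr{J}_0^{(34)},\qquad \tfrac12H=\mathscr{J}_0^{(12)}+\mathscr{J}_0^{(34)}.$$ By construction $\mathscr{K}_1,\mathscr{K}_2,\mathscr{K}_3$ obey the relations of the special Askey--Wilson algebra. The images of the Casimir elements are $$\mathscr{C}^{(1)}=\frac{1}{(1+q)^2}\big(\mathscr{L}_{12}^2+1\big),\qquad \mathscr{C}^{(2)}=\frac{1}{(1+q)^2}\big(\mathscr{L}_{34}^2+1\big).$$ Consequently, in the $q$-oscillator realization, the generators of the special Askey--Wilson algebra are expressible in terms of those of the $q$-Higgs algebra, and vice versa; hence these two algebras are isomorphic.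
   Context: Notation: $[a,b]=ab-ba$, $\{a,b\}=ab+ba$, $[x]_q=\dfrac{q^x-q^{-x}}{q-q^{-1}}$ (also for operators $x$), so $[2]_{q^{1/2}}=q^{1/2}+q^{-1/2}$. $q$-oscillators: $\mathcal{A}_q(n)$ is the unital associative $\mathbb{C}$-algebra generated by $\{A_i^\pm,A_i^0\}$, $i=1,\dots,n$, with $[A_i^0,A_i^\pm]=\pm A_i^\pm$, $[A_i^-,A_i^+]=q^{A_i^0}$, $A_i^-A_i^+-qA_i^+A_i^-=1$, elements with different indices commuting. It is represented on states $|n_1,\dots,n_n\rangle$ ($n_i\in\mathbb{N}$) by $A_i^0|n_i\rangle=n_i|n_i\rangle$, $A_i^+|n_i\rangle=\sqrt{\frac{1-q^{n_i+1}}{1-q}}\,|n_i+1\rangle$, $A_i^-|n_i\rangle=\sqrt{\frac{1-q^{n_i}}{1-q}}\,|n_i-1\rangle$. $U_q(\mathfrak{su}(1,1))$ is generated by $J_0,J_\pm$ with $[J_0,J_\pm]=\pm J_\pm$, $J_-J_+-q^2J_+J_-=q^{2J_0}[2J_0]_q$. Its coproduct is $\Delta(J_0)=J_0\otimes1+1\otimes J_0$, $\Delta(J_\pm)=J_\pm\otimes q^{2J_0}+1\otimes J_\pm$, and $\Delta^{(n)}=(\mathrm{id}^{\otimes(n-1)}\otimes\Delta)\Delta^{(n-1)}$ with $\Delta^{(1)}=\Delta$, $\Delta^{(0)}=\mathrm{id}$. Its Casimir element is $$C=J_+J_-q^{-2J_0+1}-\frac{q}{(q^2-1)^2}\big(q^{2J_0-1}+q^{-2J_0+1}\big)+\frac{q^2+1}{(q^2-1)^2}.$$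 The metaplectic representation is the homomorphism $U_q(\mathfrak{su}(1,1))\to\mathcal{A}_q(1)$ with $J_0\mapsto\frac12(A^0+\frac12)$, $J_\pm\mapsto\frac{1}{[2]_{q^{1/2}}}(A^\pm)^2$. $q$-Higgs algebra: in $\mathcal{A}_q(4)$ put $$M_\pm=\big(q^{A_2^0+\frac12}(A_1^\pm)^2+(A_2^\pm)^2\big)\big(q^{A_4^0+\frac12}(A_3^\mp)^2+(A_4^\mp)^2\big),$$ $$L=(A_1^0+A_2^0)-(A_3^0+A_4^0),\qquad H=\sum_{i=1}^4(A_i^0+\tfrac12),$$ $$\mathscr{L}_{i,i+1}=q^{-\frac12A_i^0+\frac14}\big(q^{\frac14}A_i^+A_{i+1}^--q^{-\frac14}A_i^-A_{i+1}^+\big),\quad i=1,3.$$ These satisfy $[L,M_\pm]=\pm4M_\pm$ and \begin{align*} [M_+,M_-]&=\frac{1+q}{q(1-q)^3}\,q^H\Big((q+q^{-1})(q^L-q^{-L})-2(q^{\frac12H}+q^{-\frac12H})(q^{\frac12L}-q^{-\frac12L})\Big)\\ &\quad+\frac{1+q}{q^2(1-q)}\,q^H\Big(\big(q^{-\frac12H}\mathscr{L}_{12}^2+q^{\frac12H}\mathscr{L}_{34}^2\big)q^{\frac12L}-\big(q^{\frac12H}\mathscr{L}_{12}^2+q^{-\frac12H}\mathscr{L}_{34}^2\big)q^{-\frac12L}\Big), \end{align*} with $\mathscr{L}_{12},\mathscr{L}_{34},H$ central (playing the role of structure constants). The $q$-Higgs algebra, with generators $M_\pm,L$, is defined abstractly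 by these relations; one may use $q^{\frac12L}$ as a generator instead of $L$. Special Askey--Wilson algebra: in $U_q(\mathfrak{su}(1,1))^{\otimes2}$ put $$K_1=\frac14\,\frac{1-q^{J_0}\otimes q^{-J_0}}{1-q},\qquad K_2=\tfrac12\Delta(C),\qquad K_3=[K_1,K_2].$$ With $C^{(1)}=C\otimes1$, $C^{(2)}=1\otimes C$, $J_0^{(12)}=\Delta(J_0)$, all commuting with the $K_j$, they satisfy the Askey--Wilson relations \begin{align*} [K_1,K_2]&=K_3,\\ [K_2,K_3]&=rK_2K_1K_2+\xi_1\{K_1,K_2\}+\xi_2K_2^2+\xi_3K_2+\xi_4K_1+\xi_5,\\ [K_3,K_1]&=rK_1K_2K_1+\xi_1K_1^2+\xi_2\{K_1,K_2\}+\xi_3K_1+\xi_6K_2+\xi_7, \end{align*} with $r=-(q-q^{-1})^2$, $\xi_1=\frac{1+q^{-2}}{2}$, $\xi_2=\frac{(1+q)^2(1-q)}{4q^2}$, $\xi_3=4(q-1)\xi_7$, $\xi_4=0$, $\xi_5=-\frac{(1+q)(1+q^2)}{16q^3}(C^{(1)}-C^{(2)})[J_0^{(12)}]_q$, $\xi_6=-\frac{(1+q)^2}{16q^2}$, $\xi_7=\frac{(1+q)^2}{32q^2}\big(C^{(1)}q^{J_0^{(12)}}+C^{(2)}q^{-J_0^{(12)}}-(1+q^{-2})[\tfrac12J_0^{(12)}]_q^2\big)$. The special Askey--Wilson algebra is the one with these (centrally extended) relations.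
   Formalization: For the isomorphism an inverse of 1−4(1−q)K_1 (i.e. of q^{L/2}) is adjoined to the special Askey–Wilson algebra, where it is not invertible; L_12, L_34 enter the abstract q-Higgs algebra only as central squares, and H, J_0^{(12)} only through powers of q. *)

theory Defs
  imports
    "HOL-Library.Poly_Mapping"
    "HOL-Library.Numeral_Type"
    "HOL-Algebra.QuotRing"
    "HOL-Algebra.Algebraic_Closure_Type"
    "HOL-Analysis.Complex_Transcendental"
begin

section \<open>Complex algebras given by generators and relations\<close>

text \<open>
  Words over an alphabet form a monoid under concatenation, written additively because the
  convolution product on \<open>\<Rightarrow>\<^sub>0\<close> is set up for additive monoids.  The complex monoid algebra
  of this monoid is the free unital associative algebra on the alphabet.
\<close>

datatype 'g word = Word (letters: "'g list")

instantiation word :: (type) monoid_add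
begin

definition zero_word :: "'a word" where "0 = Word []"

definition plus_word :: "'a word \<Rightarrow> 'a word \<Rightarrow> 'a word"
  where "v + w = Word (letters v @ letters w)"

instance by standard (auto simp: zero_word_def plus_word_def)

end

type_synonym 'g free_algebra = "'g word \<Rightarrow>\<^sub>0 complex"

definition scal :: "complex \<Rightarrow> 'g free_algebra"
  where "scal c = Poly_Mapping.single 0 c"

definition gen :: "'g \<Rightarrow> 'g free_algebra"
  where "gen g = Poly_Mapping.single (Word [g]) 1"

text \<open>The algebra homomorphism of free algebras with \<open>gen g \<mapsto> f g\<close>:\<close>

definition subst :: "('g \<Rightarrow> 'h free_algebra) \<Rightarrow> 'g free_algebra \<Rightarrow> 'h free_algebra"
  where "subst f p =
    (\<Sum>w\<in>Poly_Mapping.keys p. scal (Poly_Mapping.lookup p w) * prod_list (map f (letters w)))"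

definition comm :: "'a::ring \<Rightarrow> 'a \<Rightarrow> 'a" where "comm x y = x * y - y * x"

definition acomm :: "'a::ring \<Rightarrow> 'a \<Rightarrow> 'a" where "acomm x y = x * y + y * x"

text \<open>
  A set \<open>R\<close> of relators (left-hand side minus right-hand side) presents the quotient of the free
  algebra by the two-sided ideal generated by \<open>R\<close>; \<open>cls R x\<close> is the element represented by \<open>x\<close>.
\<close>

definition rel_ideal :: "'g free_algebra set \<Rightarrow> 'g free_algebra set"
  where "rel_ideal R = Idl\<^bsub>ring_of_type_algebra\<^esub> R"

definition presented :: "'g free_algebra set \<Rightarrow> 'g free_algebra set ring"
  where "presented R = ring_of_type_algebra Quot (rel_ideal R)"

definition cls :: "'g free_algebra set \<Rightarrow> 'g free_algebra \<Rightarrow> 'g free_algebra set"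
  where "cls R x = rel_ideal R +>\<^bsub>ring_of_type_algebra\<^esub> x"

text \<open>
  \<open>h\<close> is the homomorphism of unital complex algebras that sends the generator \<open>g\<close> to (the class
  of) \<open>f g\<close>.  Such an \<open>h\<close> exists iff the elements \<open>f g\<close> satisfy the relations \<open>R\<close>.
\<close>

definition alg_hom_on_gens ::
  "'g free_algebra set \<Rightarrow> 'h free_algebra set \<Rightarrow> ('g \<Rightarrow> 'h free_algebra) \<Rightarrow>
   ('g free_algebra set \<Rightarrow> 'h free_algebra set) \<Rightarrow> bool"
  where "alg_hom_on_gens R S f h \<longleftrightarrow>
    h \<in> ring_hom (presented R) (presented S) \<and> (\<forall>p. h (cls R p) = cls S (subst f p))"

text \<open>
  Tensor powers: one copy of the generators for every \<open>i \<in> I\<close>, different copies commuting.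
\<close>

definition tensor_rels :: "'i set \<Rightarrow> 'g free_algebra set \<Rightarrow> ('i \<times> 'g) free_algebra set"
  where "tensor_rels I R =
    {subst (\<lambda>g. gen (i, g)) r | i r. i \<in> I \<and> r \<in> R} \<union>
    {comm (gen (i, g)) (gen (j, h)) | i j g h. i \<in> I \<and> j \<in> I \<and> i \<noteq> j}"


section \<open>Powers of \<open>q\<close>\<close>

text \<open>
  Complex powers of \<open>q\<close> are taken with the principal logarithm.  For an operator \<open>x\<close>, the
  powers \<open>q\<^sup>s\<^sup>x\<close> (\<open>s\<close> real) are represented by a one-parameter family \<open>e s\<close>, and \<open>[x]\<^sub>q\<close> is
  \<open>qbracket q e\<close>.
\<close>

definition qpow :: "complex \<Rightarrow> real \<Rightarrow> complex"
  where "qpow q s = q powr complex_of_real s"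

definition qbracket :: "complex \<Rightarrow> (real \<Rightarrow> 'g free_algebra) \<Rightarrow> 'g free_algebra"
  where "qbracket q e = scal (1 / (q - 1 / q)) * (e 1 - e (- 1))"

definition two_sqrtq :: "complex \<Rightarrow> complex"  \<comment> \<open>\<open>[2]\<close> with base \<open>q\<^sup>1\<^sup>/\<^sup>2\<close>\<close>
  where "two_sqrtq q = qpow q (1/2) + qpow q (- 1/2)"

text \<open>Relators saying that \<open>e s\<close> behaves like the powers \<open>q\<^sup>s\<^sup>x\<close> of some \<open>x\<close>:\<close>

definition one_param_rels :: "(real \<Rightarrow> 'g free_algebra) \<Rightarrow> 'g free_algebra set"
  where "one_param_rels e = {e 0 - 1} \<union> {e s * e t - e (s + t) | s t. True}"

text \<open>Relators for \<open>q\<^sup>s\<^sup>x y = q\<^sup>s\<^sup>d y q\<^sup>s\<^sup>x\<close>, the exponentiated form of \<open>[x, y] = d y\<close>:\<close>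

definition weight_rels ::
  "complex \<Rightarrow> (real \<Rightarrow> 'g free_algebra) \<Rightarrow> real \<Rightarrow> 'g free_algebra \<Rightarrow> 'g free_algebra set"
  where "weight_rels q e d y = {e s * y - scal (qpow q (s * d)) * y * e s | s. True}"


section \<open>The \<open>q\<close>-oscillator algebra\<close>

text \<open>
  The generator \<open>QA s\<close> stands for \<open>q\<^sup>s\<^sup>A\<close> with \<open>A = A\<^sup>0\<close>; these powers are not polynomials in
  \<open>A\<^sup>0\<close> and have to be adjoined for the defining relations and the formulas below to make sense.
\<close>

datatype osc = Ap | Am | A0 | QA real

definition osc_rels :: "complex \<Rightarrow> osc free_algebra set"
  where "osc_rels q =
    {comm (gen A0) (gen Ap) - gen Ap,
     comm (gen A0) (gen Am) + gen Am,
     comm (gen Am) (gen Ap) - gen (QA 1),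
     gen Am * gen Ap - scal q * gen Ap * gen Am - 1}
    \<union> one_param_rels (\<lambda>s. gen (QA s))
    \<union> {comm (gen (QA s)) (gen A0) | s. True}
    \<union> weight_rels q (\<lambda>s. gen (QA s)) 1 (gen Ap)
    \<union> weight_rels q (\<lambda>s. gen (QA s)) (- 1) (gen Am)"

text \<open>
  \<open>\<A>\<^sub>q(4)\<close>.  The index type \<open>4\<close> consists of \<open>1, 2, 3, 4\<close> (with \<open>4 = 0\<close>).  Elements of \<open>\<A>\<^sub>q(4)\<close>
  are written as elements of the free algebra, and \<open>x \<approx>[q] y\<close> is their equality in \<open>\<A>\<^sub>q(4)\<close>.
\<close>

type_synonym osc4 = "(4 \<times> osc) free_algebra"

definition osc4_rels :: "complex \<Rightarrow> osc4 set"
  where "osc4_rels q = tensor_rels UNIV (osc_rels q)"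

abbreviation osc4_eq :: "osc4 \<Rightarrow> complex \<Rightarrow> osc4 \<Rightarrow> bool"  (\<open>(_ \<approx>[_] _)\<close> [51, 0, 51] 50)
  where "x \<approx>[q] y \<equiv> cls (osc4_rels q) x = cls (osc4_rels q) y"

abbreviation a_plus :: "4 \<Rightarrow> osc4" where "a_plus i \<equiv> gen (i, Ap)"
abbreviation a_minus :: "4 \<Rightarrow> osc4" where "a_minus i \<equiv> gen (i, Am)"
abbreviation a_zero :: "4 \<Rightarrow> osc4" where "a_zero i \<equiv> gen (i, A0)"
abbreviation q_a :: "real \<Rightarrow> 4 \<Rightarrow> osc4" where "q_a s i \<equiv> gen (i, QA s)"


section \<open>The quantum algebra of \<open>su(1,1)\<close>\<close>

datatype uq = J0 | Jp | Jm | QJ real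

definition uq_rels :: "complex \<Rightarrow> uq free_algebra set"
  where "uq_rels q =
    {comm (gen J0) (gen Jp) - gen Jp,
     comm (gen J0) (gen Jm) + gen Jm,
     gen Jm * gen Jp - scal (q^2) * gen Jp * gen Jm
       - gen (QJ 2) * qbracket q (\<lambda>s. gen (QJ (2 * s)))}
    \<union> one_param_rels (\<lambda>s. gen (QJ s))
    \<union> {comm (gen (QJ s)) (gen J0) | s. True}
    \<union> weight_rels q (\<lambda>s. gen (QJ s)) 1 (gen Jp)
    \<union> weight_rels q (\<lambda>s. gen (QJ s)) (- 1) (gen Jm)"

definition casimir :: "complex \<Rightarrow> uq free_algebra"
  where "casimir q =
    gen Jp * gen Jm * (scal q * gen (QJ (- 2)))
    - scal (q / (q^2 - 1)^2) * (scal (1 / q) * gen (QJ 2) + scal q * gen (QJ (- 2)))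
    + scal ((q^2 + 1) / (q^2 - 1)^2)"

text \<open>
  The tensor factors of \<open>U\<^sub>q\<^sup>\<otimes>\<^sup>n\<close> are numbered \<open>1, \<dots>, n\<close>.  First the coproduct of a generator,
  placed in the factors \<open>i\<close> and \<open>j\<close>; then the iterated coproduct \<open>\<Delta>\<^sup>(\<^sup>n\<^sup>)\<close>.
\<close>

primrec coproduct_gen :: "nat \<Rightarrow> nat \<Rightarrow> uq \<Rightarrow> (nat \<times> uq) free_algebra"
  where
    "coproduct_gen i j J0 = gen (i, J0) + gen (j, J0)"
  | "coproduct_gen i j Jp = gen (i, Jp) * gen (j, QJ 2) + gen (j, Jp)"
  | "coproduct_gen i j Jm = gen (i, Jm) * gen (j, QJ 2) + gen (j, Jm)"
  | "coproduct_gen i j (QJ s) = gen (i, QJ s) * gen (j, QJ s)"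

primrec coproduct :: "nat \<Rightarrow> uq free_algebra \<Rightarrow> (nat \<times> uq) free_algebra"
  where
    "coproduct 0 x = subst (\<lambda>g. gen (1, g)) x"
  | "coproduct (Suc n) x =
      subst (\<lambda>(i, g). if i = Suc n then coproduct_gen (Suc n) (Suc (Suc n)) g else gen (i, g))
        (coproduct n x)"

definition metaplectic :: "complex \<Rightarrow> uq \<Rightarrow> osc free_algebra"
  where "metaplectic q g = (case g of
      J0 \<Rightarrow> scal (1/2) * (gen A0 + scal (1/2))
    | Jp \<Rightarrow> scal (1 / two_sqrtq q) * gen Ap ^ 2
    | Jm \<Rightarrow> scal (1 / two_sqrtq q) * gen Am ^ 2
    | QJ s \<Rightarrow> scal (qpow q (s/4)) * gen (QA (s/2)))"

definition metaplectic4 :: "complex \<Rightarrow> nat \<times> uq \<Rightarrow> osc4"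
  where "metaplectic4 q = (\<lambda>(i, g). subst (\<lambda>x. gen (of_nat i, x)) (metaplectic q g))"


section \<open>The special Askey--Wilson algebra\<close>

subsection \<open>Its generators in the tensor square of the quantum algebra\<close>

definition K1 :: "complex \<Rightarrow> (nat \<times> uq) free_algebra"
  where "K1 q = scal (1/4 * (1 / (1 - q))) * (1 - gen (1, QJ 1) * gen (2, QJ (- 1)))"

definition K2 :: "complex \<Rightarrow> (nat \<times> uq) free_algebra"
  where "K2 q = scal (1/2) * coproduct 1 (casimir q)"

definition K3 :: "complex \<Rightarrow> (nat \<times> uq) free_algebra"
  where "K3 q = comm (K1 q) (K2 q)"

definition C1 :: "complex \<Rightarrow> (nat \<times> uq) free_algebra"
  where "C1 q = subst (\<lambda>g. gen (1, g)) (casimir q)"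

definition C2 :: "complex \<Rightarrow> (nat \<times> uq) free_algebra"
  where "C2 q = subst (\<lambda>g. gen (2, g)) (casimir q)"

subsection \<open>The abstract algebra\<close>

text \<open>
  \<open>AC1, AC2\<close> are the central generators \<open>C\<^sup>(\<^sup>1\<^sup>), C\<^sup>(\<^sup>2\<^sup>)\<close>, and \<open>AQ s\<close> is the power with exponent
  \<open>s J\<^sub>0\<^sup>(\<^sup>1\<^sup>2\<^sup>)\<close>, the only form in which \<open>J\<^sub>0\<^sup>(\<^sup>1\<^sup>2\<^sup>)\<close> enters the relations.
  The element \<open>1 - 4 (1 - q) K\<^sub>1\<close> is \<open>q\<^sup>x\<close> with \<open>x = J\<^sub>0 \<otimes> 1 - 1 \<otimes> J\<^sub>0\<close>; its inverse is not
  a polynomial in the \<open>K\<^sub>i\<close> and is adjoined as \<open>AKinv\<close>.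
\<close>

datatype aw = AK1 | AK2 | AK3 | AKinv | AC1 | AC2 | AQ real

definition aw_xi7 :: "complex \<Rightarrow> aw free_algebra"
  where "aw_xi7 q = scal ((1 + q)^2 / (32 * q^2)) *
    (gen AC1 * gen (AQ 1) + gen AC2 * gen (AQ (- 1))
     - scal (1 + 1 / q^2) * (qbracket q (\<lambda>s. gen (AQ (s/2))))^2)"

definition aw_rels :: "complex \<Rightarrow> aw free_algebra set"
  where "aw_rels q = (
    let k1 = gen AK1; k2 = gen AK2; k3 = gen AK3;
        r = scal (- ((q - 1/q)^2));
        xi1 = scal ((1 + 1 / q^2) / 2);
        xi2 = scal ((1 + q)^2 * (1 - q) / (4 * q^2));
        xi3 = scal (4 * (q - 1)) * aw_xi7 q;
        xi4 = scal 0;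
        xi5 = - scal ((1 + q) * (1 + q^2) / (16 * q^3)) * (gen AC1 - gen AC2)
                * qbracket q (\<lambda>s. gen (AQ s));
        xi6 = scal (- ((1 + q)^2 / (16 * q^2)));
        xi7 = aw_xi7 q;
        x = 1 - scal (4 * (1 - q)) * k1
    in
    {comm k1 k2 - k3,
     comm k2 k3 - (r * k2 * k1 * k2 + xi1 * acomm k1 k2 + xi2 * k2^2 + xi3 * k2 + xi4 * k1 + xi5),
     comm k3 k1 - (r * k1 * k2 * k1 + xi1 * k1^2 + xi2 * acomm k1 k2 + xi3 * k1 + xi6 * k2 + xi7),
     x * gen AKinv - 1, gen AKinv * x - 1}
    \<union> one_param_rels (\<lambda>s. gen (AQ s))
    \<union> {comm (gen c) (gen g) | c g. c \<in> {AC1, AC2} \<union> range AQ})"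


section \<open>The \<open>q\<close>-Higgs algebra\<close>

subsection \<open>Its realization by \<open>q\<close>-oscillators\<close>

definition oscMp :: "complex \<Rightarrow> osc4"
  where "oscMp q =
    (scal (qpow q (1/2)) * q_a 1 2 * (a_plus 1)^2 + (a_plus 2)^2) *
    (scal (qpow q (1/2)) * q_a 1 4 * (a_minus 3)^2 + (a_minus 4)^2)"

definition oscMm :: "complex \<Rightarrow> osc4"
  where "oscMm q =
    (scal (qpow q (1/2)) * q_a 1 2 * (a_minus 1)^2 + (a_minus 2)^2) *
    (scal (qpow q (1/2)) * q_a 1 4 * (a_plus 3)^2 + (a_plus 4)^2)"

definition oscL :: osc4
  where "oscL = (a_zero 1 + a_zero 2) - (a_zero 3 + a_zero 4)"

definition oscH :: osc4
  where "oscH = (a_zero 1 + scal (1/2)) + (a_zero 2 + scal (1/2))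
              + (a_zero 3 + scal (1/2)) + (a_zero 4 + scal (1/2))"

text \<open>\<open>qL s = q\<^sup>s\<^sup>L\<close> and \<open>qH q s = q\<^sup>s\<^sup>H\<close>:\<close>

definition qL :: "real \<Rightarrow> osc4"
  where "qL s = q_a s 1 * q_a s 2 * q_a (- s) 3 * q_a (- s) 4"

definition qH :: "complex \<Rightarrow> real \<Rightarrow> osc4"
  where "qH q s = scal (qpow q (2 * s)) * q_a s 1 * q_a s 2 * q_a s 3 * q_a s 4"

definition oscLL :: "complex \<Rightarrow> 4 \<Rightarrow> 4 \<Rightarrow> osc4"
  where "oscLL q i j = scal (qpow q (1/4)) * q_a (- 1/2) i *
    (scal (qpow q (1/4)) * a_plus i * a_minus j - scal (qpow q (- 1/4)) * a_minus i * a_plus j)"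

subsection \<open>The abstract algebra\<close>

text \<open>
  \<open>HX\<close> and \<open>HXinv\<close> stand for \<open>q\<^sup>L\<^sup>/\<^sup>2\<close> and its inverse, \<open>HQ s\<close> for \<open>q\<^sup>s\<^sup>H\<close>, and
  \<open>HLL12, HLL34\<close> for the \<^emph>\<open>squares\<close> of the structure constants \<open>\<L>\<^sub>1\<^sub>2, \<L>\<^sub>3\<^sub>4\<close>, which are all that
  the relations contain.
\<close>

datatype higgs = HMp | HMm | HX | HXinv | HLL12 | HLL34 | HQ real

definition higgs_rels :: "complex \<Rightarrow> higgs free_algebra set"
  where "higgs_rels q = (
    let mp = gen HMp; mm = gen HMm; x = gen HX; y = gen HXinv;
        l12 = gen HLL12; l34 = gen HLL34; h = (\<lambda>s. gen (HQ s))
    in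
    {x * y - 1, y * x - 1,
     x * mp - scal (q^2) * mp * x,
     x * mm - scal (1 / q^2) * mm * x,
     comm mp mm -
      (scal ((1 + q) / (q * (1 - q)^3)) * h 1 *
         (scal (q + 1/q) * (x^2 - y^2) - 2 * (h (1/2) + h (- 1/2)) * (x - y))
       + scal ((1 + q) / (q^2 * (1 - q))) * h 1 *
         ((h (- 1/2) * l12 + h (1/2) * l34) * x - (h (1/2) * l12 + h (- 1/2) * l34) * y))}
    \<union> one_param_rels h
    \<union> {comm (gen c) (gen g) | c g. c \<in> {HLL12, HLL34} \<union> range HQ})"


section \<open>The realization of the special Askey--Wilson algebra by \<open>q\<close>-oscillators\<close>

definition pair_realization :: "complex \<Rightarrow> 4 \<Rightarrow> 4 \<Rightarrow> uq \<Rightarrow> osc4"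
  where "pair_realization q i j g = (case g of
      J0 \<Rightarrow> scal (1/2) * (a_zero i + a_zero j + 1)
    | Jp \<Rightarrow> scal (1 / two_sqrtq q) *
             (scal (qpow q (1/2)) * q_a 1 j * (a_plus i)^2 + (a_plus j)^2)
    | Jm \<Rightarrow> scal (1 / two_sqrtq q) *
             (scal (qpow q (1/2)) * q_a 1 j * (a_minus i)^2 + (a_minus j)^2)
    | QJ s \<Rightarrow> scal (qpow q (s/2)) * q_a (s/2) i * q_a (s/2) j)"

definition calJ :: "complex \<Rightarrow> nat \<times> uq \<Rightarrow> osc4"
  where "calJ q = (\<lambda>(i, g). pair_realization q (of_nat (2 * i - 1)) (of_nat (2 * i)) g)"

definition calK1 :: "complex \<Rightarrow> osc4" where "calK1 q = subst (calJ q) (K1 q)"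
definition calK2 :: "complex \<Rightarrow> osc4" where "calK2 q = subst (calJ q) (K2 q)"
definition calK3 :: "complex \<Rightarrow> osc4" where "calK3 q = subst (calJ q) (K3 q)"
definition calC1 :: "complex \<Rightarrow> osc4" where "calC1 q = subst (calJ q) (C1 q)"
definition calC2 :: "complex \<Rightarrow> osc4" where "calC2 q = subst (calJ q) (C2 q)"

primrec aw_realization :: "complex \<Rightarrow> aw \<Rightarrow> osc4"
  where
    "aw_realization q AK1 = calK1 q"
  | "aw_realization q AK2 = calK2 q"
  | "aw_realization q AK3 = calK3 q"
  | "aw_realization q AKinv = subst (calJ q) (gen (1, QJ (- 1)) * gen (2, QJ 1))"
  | "aw_realization q AC1 = calC1 q"
  | "aw_realization q AC2 = calC2 q"
  | "aw_realization q (AQ s) = subst (calJ q) (coproduct 1 (gen (QJ s)))"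

primrec higgs_realization :: "complex \<Rightarrow> higgs \<Rightarrow> osc4"
  where
    "higgs_realization q HMp = oscMp q"
  | "higgs_realization q HMm = oscMm q"
  | "higgs_realization q HX = qL (1/2)"
  | "higgs_realization q HXinv = qL (- 1/2)"
  | "higgs_realization q HLL12 = (oscLL q 1 2)^2"
  | "higgs_realization q HLL34 = (oscLL q 3 4)^2"
  | "higgs_realization q (HQ s) = qH q s"

definition higgs_C1 :: "complex \<Rightarrow> higgs free_algebra"
  where "higgs_C1 q = scal (1 / (1 + q)^2) * (gen HLL12 + 1)"

definition higgs_C2 :: "complex \<Rightarrow> higgs free_algebra"
  where "higgs_C2 q = scal (1 / (1 + q)^2) * (gen HLL34 + 1)"

text \<open>
  The generators of the special Askey--Wilson algebra expressed in those of the \<open>q\<close>-Higgs algebra.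
  In the formula for \<open>K\<^sub>2\<close> the product \<open>[(L+H)/4]\<^sub>q [(L-H)/4]\<^sub>q\<close> is expanded as
  \<open>(q\<^sup>L\<^sup>/\<^sup>2 + q\<^sup>-\<^sup>L\<^sup>/\<^sup>2 - q\<^sup>H\<^sup>/\<^sup>2 - q\<^sup>-\<^sup>H\<^sup>/\<^sup>2) / (q - q\<^sup>-\<^sup>1)\<^sup>2\<close>, since \<open>q\<^sup>L\<^sup>/\<^sup>4\<close> is not in the algebra.
\<close>

primrec aw_to_higgs :: "complex \<Rightarrow> aw \<Rightarrow> higgs free_algebra"
  where
    "aw_to_higgs q AK1 = scal (1/4 * (1 / (1 - q))) * (1 - gen HX)"
  | "aw_to_higgs q AK2 = scal (1/2) *
      ((higgs_C1 q * gen (HQ (1/2)) + higgs_C2 q * gen (HQ (- 1/2))) * gen HXinv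
       + scal (1 + 1 / q^2) * gen HXinv *
           (scal (1 / (q - 1/q)^2) *
             (gen HX + gen HXinv - gen (HQ (1/2)) - gen (HQ (- 1/2))))
       + scal (q / (1 + q)^2) * (scal (1 / q) * gen HMp + scal q * gen HMm) *
           (gen (HQ (- 1/2)) * gen HXinv))"
  | "aw_to_higgs q AK3 = scal (1 / (8 * (1 + q))) * (gen HMp - gen HMm) * gen (HQ (- 1/2))"
  | "aw_to_higgs q AKinv = gen HXinv"
  | "aw_to_higgs q AC1 = higgs_C1 q"
  | "aw_to_higgs q AC2 = higgs_C2 q"
  | "aw_to_higgs q (AQ s) = gen (HQ (s/2))"

end

theory Submission
  imports Defs
begin

text \<open>
  Everything is computed in \<open>U \<otimes> U\<close> and in the abstract algebras; oscillators enter only through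
  the metaplectic representation and the Casimir elements of a pair.  In \<open>U \<otimes> U\<close> the elements
  \<open>J\<^sub>\<plusminus> \<otimes> J\<^sub>\<mp>\<close> satisfy the Higgs relations, and the cross terms of \<open>\<Delta>(C)\<close> are combinations
  of them, which gives the formulas for \<open>K\<^sub>2\<close> and \<open>K\<^sub>3\<close>.  These formulas make sense in the abstract Higgs
  algebra.  Modulo the weight relations of \<open>M\<^sub>\<plusminus>\<close> alone, the first and third Askey--Wilson relations
  hold for them and the second relator is an invertible multiple of the relator for
  \<open>[M\<^sub>+, M\<^sub>-]\<close>.  Conversely, the first and third Askey--Wilson relations say that \<open>q\<^sup>L\<^sup>/\<^sup>2\<close>
  acts on the span of \<open>K\<^sub>2, K\<^sub>3\<close> (modulo functions of \<open>L\<close>) with eigenvalues \<open>q\<^sup>\<plusminus>\<^sup>2\<close>, and \<open>M\<^sub>\<plusminus>\<close>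
  are recovered as the eigenvectors.
\<close>

section \<open>Free algebras and presented algebras\<close>

text \<open>Most computations have two layers. Relations, oriented as rewrite rules, order the
  noncommutative monomials; linear functionals then turn the identity into one between complex
  numbers, where partial fractions in q keep the coefficients under control. The delicate relation
  is the one for [M_+, M_-]. In the full Higgs algebra its relator and the image of the second
  Askey-Wilson relator both vanish, so an equation between them would say nothing there. The
  proportionality is therefore proved in an auxiliary algebra that has only the weight relations.
  Read in one direction it gives the second Askey-Wilson relation; mapped back to the Askey-Wilson
  algebra it gives the Higgs relation, which is never evaluated there directly. The special
  structure constants make this work. With X = q^(L/2), K_1 = (1 - X) / (4 (1 - q)); then r / (4 (1
  - q)) = - xi_2 cancels the K_2^2 terms of the second relation, and xi_3 = - 4 (1 - q) xi_7 turns
  xi_3 K_1 + xi_7 into xi_7 X in the third.\<close>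

lemma ring_of_type_algebra_ring: "ring (ring_of_type_algebra :: 'a::ring_1 ring)"
proof -
  have "\<exists>y. x + y = 0" for x :: 'a
    using add.right_inverse by blast
  thus ?thesis
    unfolding ring_of_type_algebra_def using add.right_inverse
    by unfold_locales (auto simp: algebra_simps Units_def)
qed

lemma rel_ideal_ideal: "ideal (rel_ideal R) ring_of_type_algebra"
  unfolding rel_ideal_def
  by (rule ring.genideal_ideal[OF ring_of_type_algebra_ring]) (simp add: ring_of_type_algebra_def)

lemma rel_ideal_base: "r \<in> R \<Longrightarrow> r \<in> rel_ideal R"
  unfolding rel_ideal_def using ring.genideal_self[OF ring_of_type_algebra_ring, of R]
  by (auto simp: ring_of_type_algebra_def)

lemma rel_ideal_zero: "0 \<in> rel_ideal R"
  using additive_subgroup.zero_closed[OF ideal.axioms(1)[OF rel_ideal_ideal[of R]]]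
  by (simp add: ring_of_type_algebra_def)

lemma rel_ideal_add: "x \<in> rel_ideal R \<Longrightarrow> y \<in> rel_ideal R \<Longrightarrow> x + y \<in> rel_ideal R"
  using additive_subgroup.a_closed[OF ideal.axioms(1)[OF rel_ideal_ideal[of R]]]
  by (simp add: ring_of_type_algebra_def)

lemma rel_ideal_mult_left: "x \<in> rel_ideal R \<Longrightarrow> y * x \<in> rel_ideal R"
  using ideal.I_l_closed[OF rel_ideal_ideal[of R], of x y]
  by (simp add: ring_of_type_algebra_def)

lemma rel_ideal_mult_right: "x \<in> rel_ideal R \<Longrightarrow> x * y \<in> rel_ideal R"
  using ideal.I_r_closed[OF rel_ideal_ideal[of R], of x y]
  by (simp add: ring_of_type_algebra_def)

lemma rel_ideal_uminus: "x \<in> rel_ideal R \<Longrightarrow> - x \<in> rel_ideal R"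
  using rel_ideal_mult_left[of x R "-1"] by simp

lemma rel_ideal_diff: "x \<in> rel_ideal R \<Longrightarrow> y \<in> rel_ideal R \<Longrightarrow> x - y \<in> rel_ideal R"
  using rel_ideal_add[of x R "- y"] rel_ideal_uminus[of y R] by simp

lemma rel_ideal_trans: "x - y \<in> rel_ideal R \<Longrightarrow> y - z \<in> rel_ideal R \<Longrightarrow> x - z \<in> rel_ideal R"
  using rel_ideal_add[of "x - y" R "y - z"] by simp

lemma rel_ideal_diff_cong:
  assumes "x - x' \<in> rel_ideal R" "y - y' \<in> rel_ideal R"
  shows "x - y - (x' - y') \<in> rel_ideal R"
  using rel_ideal_diff[OF assms] by (simp add: algebra_simps)

lemma rel_ideal_mult_cong:
  assumes "x - x' \<in> rel_ideal R" "y - y' \<in> rel_ideal R"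
  shows "x * y - x' * y' \<in> rel_ideal R"
proof -
  have "x * y - x' * y' = (x - x') * y + x' * (y - y')"
    by (simp add: algebra_simps)
  then show ?thesis
    using assms by (auto intro: rel_ideal_add rel_ideal_mult_left rel_ideal_mult_right)
qed

lemma rel_ideal_minimal:
  assumes "R \<subseteq> J" "0 \<in> J" "\<And>x y. x \<in> J \<Longrightarrow> y \<in> J \<Longrightarrow> x + y \<in> J"
    and "\<And>x y. x \<in> J \<Longrightarrow> y * x \<in> J" "\<And>x y. x \<in> J \<Longrightarrow> x * y \<in> J"
  shows "rel_ideal R \<subseteq> J"
proof -
  have um: "- x \<in> J" if "x \<in> J" for x
    using assms(4)[OF that, of "-1"] by simp
  have inv: "x \<in> J \<Longrightarrow> \<exists>y\<in>J. y + x = 0 \<and> x + y = 0" for x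
    using um by (intro bexI[of _ "- x"]) auto
  interpret ring "ring_of_type_algebra :: 'a free_algebra ring"
    by (rule ring_of_type_algebra_ring)
  have "ideal J ring_of_type_algebra"
  proof (rule idealI)
    show "subgroup J (add_monoid ring_of_type_algebra)"
    proof (rule add.subgroupI)
      fix a assume a: "a \<in> J"
      have "\<ominus>\<^bsub>ring_of_type_algebra\<^esub> a = - a"
        by (rule minus_equality) (auto simp: ring_of_type_algebra_def)
      then show "\<ominus>\<^bsub>ring_of_type_algebra\<^esub> a \<in> J" using um[OF a] by simp
    qed (use assms in \<open>auto simp: ring_of_type_algebra_def\<close>)
  qed (use assms ring_of_type_algebra_ring in \<open>auto simp: ring_of_type_algebra_def\<close>)
  then show ?thesis
    unfolding rel_ideal_def by (rule genideal_minimal) (rule assms(1))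
qed

lemma cls_eq_iff: "cls R x = cls R y \<longleftrightarrow> x - y \<in> rel_ideal R"
proof -
  have cls: "cls R x = {h + x | h. h \<in> rel_ideal R}" for x
    by (auto simp: cls_def a_r_coset_def r_coset_def ring_of_type_algebra_def)
  show ?thesis
  proof
    assume "cls R x = cls R y"
    moreover have "x \<in> cls R x" unfolding cls using rel_ideal_zero[of R] by force
    ultimately show "x - y \<in> rel_ideal R" unfolding cls by auto
  next
    assume *: "x - y \<in> rel_ideal R"
    have "z \<in> cls R y" if "z \<in> cls R x" "x - y \<in> rel_ideal R" for x y z
    proof -
      from that(1) obtain h where "h \<in> rel_ideal R" "z = h + x" unfolding cls by auto
      then have "h + (x - y) \<in> rel_ideal R" "z = (h + (x - y)) + y"
        using that(2) by (auto intro: rel_ideal_add)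
      then show ?thesis unfolding cls by blast
    qed
    moreover have "y - x \<in> rel_ideal R" using rel_ideal_uminus[OF *] by simp
    ultimately show "cls R x = cls R y" using * by blast
  qed
qed

lemma cls_eq_0: "r \<in> R \<Longrightarrow> cls R r = cls R 0"
  by (simp add: cls_eq_iff rel_ideal_base)

lemma carrier_presented: "carrier (presented R) = range (cls R)"
  by (auto simp: presented_def FactRing_def A_RCOSETS_def RCOSETS_def cls_def a_r_coset_def
      ring_of_type_algebra_def)

lemma ring_hom_presentedI:
  assumes "\<And>p. h (cls R p) = cls S (F p)"
    and "\<And>x y. cls S (F (x + y)) = cls S (F x + F y)"
    and "\<And>x y. cls S (F (x * y)) = cls S (F x * F y)"
    and "cls S (F 1) = cls S 1"
  shows "h \<in> ring_hom (presented R) (presented S)"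
proof -
  have hom: "cls R' \<in> ring_hom ring_of_type_algebra (presented R')" for R' :: "'c free_algebra set"
    unfolding presented_def cls_def by (rule ideal.rcos_ring_hom[OF rel_ideal_ideal])
  have mult: "cls R' x \<otimes>\<^bsub>presented R'\<^esub> cls R' y = cls R' (x * y)" for R' :: "'c free_algebra set" and x y
    using ring_hom_mult[OF hom, of x y R'] by (simp add: ring_of_type_algebra_def)
  have add: "cls R' x \<oplus>\<^bsub>presented R'\<^esub> cls R' y = cls R' (x + y)" for R' :: "'c free_algebra set" and x y
    using ring_hom_add[OF hom, of x y R'] by (simp add: ring_of_type_algebra_def)
  have one: "\<one>\<^bsub>presented R'\<^esub> = cls R' 1" for R' :: "'c free_algebra set"
    using ring_hom_one[OF hom, of R'] by (simp add: ring_of_type_algebra_def)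
  show ?thesis
  proof (rule ring_hom_memI)
    show "h \<one>\<^bsub>presented R\<^esub> = \<one>\<^bsub>presented S\<^esub>"
      using one[of R] one[of S] assms by simp
  qed (use assms in \<open>auto simp: carrier_presented mult add\<close>)
qed

section \<open>Scalars, words and substitution in free algebras\<close>

lemma scal_0 [simp]: "scal 0 = 0"
  by (simp add: scal_def)

lemma scal_1: "scal 1 = 1"
  by (simp add: scal_def)

lemma scal_add: "scal (a + b) = scal a + scal b"
  by (simp add: scal_def single_add)

lemma scal_mult: "scal (a * b) = scal a * scal b"
  by (simp add: scal_def mult_single)

lemma scal_uminus: "scal (- a) = - scal a"
  by (simp add: scal_def single_uminus)

lemma scal_single: "scal a * Poly_Mapping.single w c = Poly_Mapping.single w (a * c)"
  by (simp add: scal_def mult_single)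

lemma single_scal: "Poly_Mapping.single w c * scal a = Poly_Mapping.single w (a * c)"
  by (simp add: scal_def mult_single mult.commute)

lemma free_algebra_induct [case_names zero single add]:
  fixes p :: "'g free_algebra"
  assumes "P 0" "\<And>w c. P (Poly_Mapping.single w c)" "\<And>x y. P x \<Longrightarrow> P y \<Longrightarrow> P (x + y)"
  shows "P p"
proof (induct p rule: update_induct)
  case (update f a b)
  then have "Poly_Mapping.update a b f = f + Poly_Mapping.single a b"
    by (intro poly_mapping_eqI) (auto simp: lookup_update lookup_add lookup_single in_keys_iff when_def)
  then show ?case using update assms by simp
qed (rule assms)

lemma scal_commute: "scal a * x = x * scal a"
  by (induct x rule: free_algebra_induct) (auto simp: scal_single single_scal algebra_simps)

lemma single_eq_prod_gens:
  "Poly_Mapping.single w c = scal c * prod_list (map gen (letters w))"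
proof -
  have "prod_list (map gen gs) = Poly_Mapping.single (Word gs) 1" for gs :: "'a list"
    by (induct gs) (auto simp: gen_def mult_single plus_word_def simp flip: zero_word_def)
  then show ?thesis by (simp add: scal_single)
qed

lemma subst_superset:
  assumes "finite A" "Poly_Mapping.keys p \<subseteq> A"
  shows "subst f p = (\<Sum>w\<in>A. scal (Poly_Mapping.lookup p w) * prod_list (map f (letters w)))"
  unfolding subst_def using assms
  by (intro sum.mono_neutral_left) (auto simp: in_keys_iff)

lemma subst_add: "subst f (x + y) = subst f x + subst f y"
proof -
  let ?A = "Poly_Mapping.keys x \<union> Poly_Mapping.keys y"
  have "Poly_Mapping.keys (x + y) \<subseteq> ?A" by (rule keys_add)
  then show ?thesis
    by (simp add: subst_superset[of ?A] lookup_add scal_add algebra_simps sum.distrib)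
qed

lemma subst_0: "subst f 0 = 0"
  by (simp add: subst_def)

lemma subst_single: "subst f (Poly_Mapping.single w c) = scal c * prod_list (map f (letters w))"
  by (cases "c = 0") (auto simp: subst_def)

lemma subst_uminus: "subst f (- x) = - subst f x"
  using subst_add[of f x "- x"] by (simp add: subst_0 eq_neg_iff_add_eq_0 add.commute)

lemma subst_diff: "subst f (x - y) = subst f x - subst f y"
  using subst_add[of f x "- y"] by (simp add: subst_uminus)

lemma subst_mult: "subst f (x * y) = subst f x * subst f y"
proof (induct x rule: free_algebra_induct)
  case (single v c)
  show ?case
  proof (induct y rule: free_algebra_induct)
    case (single w d)
    have "scal (c * d) * (a * b) = scal c * a * (scal d * b)" for a b
      by (simp add: scal_mult mult.assoc) (metis mult.assoc scal_commute)
    then show ?case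
      by (simp add: mult_single subst_single plus_word_def)
  qed (auto simp: subst_0 subst_add algebra_simps)
qed (auto simp: subst_0 subst_add algebra_simps)

lemma subst_scal: "subst f (scal c) = scal c"
  by (simp add: scal_def[of c] subst_single zero_word_def)

lemma subst_1: "subst f 1 = 1"
  using subst_scal[of f 1] by (simp add: scal_1)

lemma subst_numeral: "subst f (numeral k) = numeral k"
proof -
  have "numeral k = (scal (numeral k) :: 'c free_algebra)" for k
    by (simp add: scal_def)
  then show ?thesis by (metis subst_scal)
qed

lemma subst_power: "subst f (x ^ n) = subst f x ^ n"
  by (induct n) (auto simp: subst_1 subst_mult)

lemma subst_gen: "subst f (gen g) = f g"
  by (simp add: gen_def subst_single scal_1)

lemma subst_prod_list: "subst f (prod_list xs) = prod_list (map (subst f) xs)"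
  by (induct xs) (auto simp: subst_1 subst_mult)

lemma subst_subst: "subst f (subst g p) = subst (\<lambda>x. subst f (g x)) p"
  by (induct p rule: free_algebra_induct)
    (auto simp: subst_0 subst_add subst_single subst_mult subst_scal subst_prod_list o_def)

lemma subst_gen_id: "subst gen p = p"
  by (induct p rule: free_algebra_induct)
    (auto simp: subst_0 subst_add subst_single simp flip: single_eq_prod_gens)

lemma subst_comm: "subst f (comm x y) = comm (subst f x) (subst f y)"
  by (simp add: comm_def subst_diff subst_mult)

lemma subst_acomm: "subst f (acomm x y) = acomm (subst f x) (subst f y)"
  by (simp add: acomm_def subst_add subst_mult)

lemmas subst_simps = subst_add subst_0 subst_uminus subst_diff subst_mult subst_scal subst_1
  subst_numeral subst_power subst_gen subst_comm subst_acomm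

section \<open>Calculations in a presented algebra\<close>

text \<open>
  The presented algebras depend on parameters, so a single one of them is not a type.  The product
  of the algebras presented by \<^emph>\<open>all\<close> sets of relators is one, and \<open>el R x\<close> is the class of \<open>x\<close>
  in the factor \<open>R\<close>.  Every factor is a (non-unital) subring, so that equations in it can be
  used as rewrite rules.
\<close>

text \<open>Otherwise transfer would go down to coefficient functions of free algebra elements.\<close>

lifting_forget poly_mapping.lifting

quotient_type 'g presented_prod = "'g free_algebra set \<Rightarrow> 'g free_algebra" /
  "\<lambda>x y. \<forall>R. x R - y R \<in> rel_ideal R"
proof (rule equivpI)
  show "reflp (\<lambda>x y. \<forall>R. x R - y R \<in> rel_ideal R)"
    by (auto simp: reflp_def rel_ideal_zero)
  show "symp (\<lambda>x y. \<forall>R. x R - y R \<in> rel_ideal R)"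
    unfolding symp_def using rel_ideal_uminus by fastforce
  show "transp (\<lambda>x y. \<forall>R. x R - y R \<in> rel_ideal R)"
    unfolding transp_def using rel_ideal_trans by metis
qed

instantiation presented_prod :: (type) ring
begin

lift_definition zero_presented_prod :: "'a presented_prod" is "\<lambda>R. 0" .

lift_definition plus_presented_prod :: "'a presented_prod \<Rightarrow> 'a presented_prod \<Rightarrow> 'a presented_prod"
  is "\<lambda>x y R. x R + y R"
  by (metis rel_ideal_add add_diff_add)

lift_definition uminus_presented_prod :: "'a presented_prod \<Rightarrow> 'a presented_prod"
  is "\<lambda>x R. - x R"
  by (metis rel_ideal_uminus minus_diff_minus)

lift_definition minus_presented_prod :: "'a presented_prod \<Rightarrow> 'a presented_prod \<Rightarrow> 'a presented_prod"
  is "\<lambda>x y R. x R - y R"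
  by (metis rel_ideal_diff_cong)

lift_definition times_presented_prod :: "'a presented_prod \<Rightarrow> 'a presented_prod \<Rightarrow> 'a presented_prod"
  is "\<lambda>x y R. x R * y R"
  by (metis rel_ideal_mult_cong)

instance
  by standard (transfer; simp add: algebra_simps rel_ideal_zero)+

end

lift_definition cscale :: "complex \<Rightarrow> 'g presented_prod \<Rightarrow> 'g presented_prod"
  is "\<lambda>c x R. scal c * x R"
  by (simp add: rel_ideal_mult_left flip: right_diff_distrib)

lift_definition el :: "'g free_algebra set \<Rightarrow> 'g free_algebra \<Rightarrow> 'g presented_prod"
  is "\<lambda>R x S. if S = R then x else 0" .

lemma el_eq_iff: "el R x = el R y \<longleftrightarrow> cls R x = cls R y"
  unfolding cls_eq_iff by transfer (auto simp: rel_ideal_zero)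

lemma el_0: "el R 0 = 0"
  by transfer (auto simp: rel_ideal_zero)

lemma el_add: "el R (x + y) = el R x + el R y"
  by transfer (auto simp: rel_ideal_zero)

lemma el_uminus: "el R (- x) = - el R x"
  by transfer (auto simp: rel_ideal_zero)

lemma el_diff: "el R (x - y) = el R x - el R y"
  by transfer (auto simp: rel_ideal_zero)

lemma el_mult: "el R (x * y) = el R x * el R y"
  by transfer (auto simp: rel_ideal_zero)

lemma el_scal_mult: "el R (scal c * x) = cscale c (el R x)"
  by transfer (auto simp: rel_ideal_zero)

text \<open>\<open>el R 1\<close> is the unit of one factor only, and the product type is given no
  unit of its own. Scalars and numerals therefore become multiples of \<open>el R 1\<close>, which
  \<open>el_1_mult\<close> absorbs.\<close>

lemma el_scal: "el R (scal c) = cscale c (el R 1)"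
  using el_scal_mult[of R c 1] by simp

lemma el_numeral: "el R (numeral k) = cscale (numeral k) (el R 1)"
  using el_scal[of R "numeral k"] by (simp add: scal_def)

lemma el_square: "el R (x\<^sup>2) = el R x * el R x"
  by (simp add: power2_eq_square el_mult)

lemma el_comm: "el R (comm x y) = el R x * el R y - el R y * el R x"
  by (simp add: comm_def el_mult el_diff)

lemma el_acomm: "el R (acomm x y) = el R x * el R y + el R y * el R x"
  by (simp add: acomm_def el_mult el_add)

lemma el_1_mult: "el R 1 * el R x = el R x" "el R x * el R 1 = el R x"
  by (simp_all flip: el_mult)

lemma el_1_mult_left: "el R 1 * (el R x * z) = el R x * z" "el R x * (el R 1 * z) = el R x * z"
  by (simp_all add: el_1_mult flip: mult.assoc)

lemma cscale_mult: "cscale c x * y = cscale c (x * y)" "x * cscale c y = cscale c (x * y)"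
proof -
  show "cscale c x * y = cscale c (x * y)"
    by transfer (simp add: mult.assoc rel_ideal_zero)
  show "x * cscale c y = cscale c (x * y)"
  proof transfer
    fix c and x y :: "'a free_algebra set \<Rightarrow> 'a free_algebra"
    have "x R * (scal c * y R) - scal c * (x R * y R) = 0" for R
      by (simp add: scal_commute[of c "x R"] flip: mult.assoc)
    then show "\<forall>R. x R * (scal c * y R) - scal c * (x R * y R) \<in> rel_ideal R"
      by (simp add: rel_ideal_zero)
  qed
qed

interpretation presented_prod: vector_space "cscale :: complex \<Rightarrow> 'g presented_prod \<Rightarrow> _"
  by unfold_locales
    (transfer; simp add: scal_add scal_mult scal_1 algebra_simps rel_ideal_zero)+

text \<open>
  The coordinate of \<open>v\<close> at \<open>z\<close> in some basis that contains \<open>z\<close> (if \<open>z \<noteq> 0\<close>).  Comparing all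
  coordinates turns an identity between linear combinations of monomials into an identity of complex
  numbers with the coordinates of the monomials as indeterminates.
\<close>

definition coord :: "'g presented_prod \<Rightarrow> 'g presented_prod \<Rightarrow> complex"
  where "coord z v =
    (if z = 0 then 0
     else presented_prod.representation (presented_prod.extend_basis {z}) v z)"

lemma extend_basis_singleton:
  assumes "z \<noteq> 0"
  shows "presented_prod.independent (presented_prod.extend_basis {z})"
    "presented_prod.span (presented_prod.extend_basis {z}) = UNIV"
    "z \<in> presented_prod.extend_basis {z}"
proof -
  have "presented_prod.independent {z}"
    using assms by simp
  then show "presented_prod.independent (presented_prod.extend_basis {z})"
    "presented_prod.span (presented_prod.extend_basis {z}) = UNIV"
    "z \<in> presented_prod.extend_basis {z}"
    using presented_prod.extend_basis_superset presented_prod.independent_extend_basis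
      presented_prod.span_extend_basis by blast+
qed

lemma coord_add: "coord z (x + y) = coord z x + coord z y"
  by (simp add: coord_def extend_basis_singleton presented_prod.representation_add)

lemma coord_scale: "coord z (cscale c x) = c * coord z x"
  by (simp add: coord_def extend_basis_singleton presented_prod.representation_scale)

lemma coord_uminus: "coord z (- x) = - coord z x"
  using coord_scale[of z "-1" x] by (simp add: presented_prod.scale_minus_left)

lemma coord_diff: "coord z (x - y) = coord z x - coord z y"
  using coord_add[of z x "- y"] by (simp add: coord_uminus)

lemma coord_0: "coord z 0 = 0"
  using coord_add[of z 0 0] by simp

text \<open>A nonzero difference \<open>x - y\<close> is itself a vector of the basis chosen for
  \<open>coord (x - y)\<close>, so its coordinate there is 1. Hence these functionals separate
  points.\<close>

lemma eq_by_coords: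
  assumes "\<And>z. coord z x = coord z y"
  shows "x = y"
proof (rule ccontr)
  assume "x \<noteq> y"
  then have "coord (x - y) (x - y) = 1"
    by (simp add: coord_def extend_basis_singleton presented_prod.representation_basis)
  then show False
    using assms by (simp add: coord_diff)
qed

lemmas coord_simps = coord_add coord_scale coord_uminus coord_diff coord_0

lemmas el_simps = el_add el_0 el_uminus el_diff el_mult el_scal_mult el_scal el_numeral el_square
  el_comm el_acomm el_1_mult el_1_mult_left

lemmas expand_simps = distrib_left distrib_right left_diff_distrib right_diff_distrib mult.assoc
  cscale_mult

section \<open>Homomorphisms between presented algebras\<close>

lemma el_rel: "r \<in> R \<Longrightarrow> el R r = 0"
  using cls_eq_0 by (auto simp: el_eq_iff[symmetric] el_0)

text \<open>The polynomials that vanish in \<open>S\<close> after substitution form a two-sided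
  ideal; it contains \<open>R\<close>, hence \<open>rel_ideal R\<close>.\<close>

lemma el_subst_cong:
  assumes "\<And>r. r \<in> R \<Longrightarrow> el S (subst f r) = 0" "el R p = el R p'"
  shows "el S (subst f p) = el S (subst f p')"
proof -
  have iff: "x \<in> rel_ideal T \<longleftrightarrow> el T x = 0" for T and x :: "'x free_algebra"
    using el_eq_iff[of T x 0] by (simp add: cls_eq_iff el_0)
  have "rel_ideal R \<subseteq> {p. el S (subst f p) = 0}"
    by (rule rel_ideal_minimal) (auto simp: assms subst_simps el_add el_mult el_0)
  moreover have "p - p' \<in> rel_ideal R"
    using assms(2) by (simp add: el_eq_iff cls_eq_iff)
  ultimately show ?thesis
    by (auto simp: subst_diff el_diff)
qed

lemma el_subset:
  assumes "R \<subseteq> S" "el R x = el R y"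
  shows "el S x = el S y"
proof -
  have "el S r = 0" if "r \<in> R" for r
    using assms(1) that by (auto intro: el_rel)
  then show ?thesis
    using el_subst_cong[of R S gen x y] assms(2) by (simp add: subst_gen_id)
qed

lemma el_subst_eqI:
  assumes "\<And>g. el S (f g) = el S (f' g)"
  shows "el S (subst f p) = el S (subst f' p)"
proof (induct p rule: free_algebra_induct)
  case (single w c)
  have "el S (prod_list (map f gs)) = el S (prod_list (map f' gs))" for gs
    by (induct gs) (auto simp: el_mult assms)
  then show ?case by (simp add: subst_single el_scal_mult)
qed (auto simp: subst_simps el_add)

lemma el_commute_subst:
  assumes "\<And>g. el S x * el S (f g) = el S (f g) * el S x"
  shows "el S x * el S (subst f p) = el S (subst f p) * el S x"
proof (induct p rule: free_algebra_induct)
  case (single w c)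
  have "el S x * el S (prod_list (map f gs)) = el S (prod_list (map f gs)) * el S x" for gs
  proof (induct gs)
    case (Cons g gs)
    then show ?case
      by (simp add: el_mult) (metis assms mult.assoc)
  qed (simp add: el_1_mult)
  then show ?case by (simp add: subst_single el_scal_mult cscale_mult)
qed (auto simp: subst_simps el_add el_0 algebra_simps)

lemma el_eq_subst_id:
  assumes "\<And>g. el R (f g) = el R (gen g)"
  shows "el R (subst f p) = el R p"
  using el_subst_eqI[of R f gen p] assms by (simp add: subst_gen_id)

lemma tensor_rels_respected:
  assumes "\<And>i r. i \<in> I \<Longrightarrow> r \<in> R \<Longrightarrow> el S (subst (\<lambda>g. f (i, g)) r) = 0"
    and "\<And>i j g h. i \<in> I \<Longrightarrow> j \<in> I \<Longrightarrow> i \<noteq> j \<Longrightarrow>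
      el S (f (i, g)) * el S (f (j, h)) = el S (f (j, h)) * el S (f (i, g))"
    and "r \<in> tensor_rels I R"
  shows "el S (subst f r) = 0"
  using assms(3) unfolding tensor_rels_def
  by (auto simp: subst_subst subst_gen subst_comm el_comm assms(1,2))

lemma tensor_rels_el_commute:
  assumes "i \<in> I" "j \<in> I" "i \<noteq> j"
  shows "el (tensor_rels I R) (gen (i, g)) * el (tensor_rels I R) (gen (j, h)) =
    el (tensor_rels I R) (gen (j, h)) * el (tensor_rels I R) (gen (i, g))"
proof -
  have "comm (gen (i, g)) (gen (j, h)) \<in> tensor_rels I R"
    using assms unfolding tensor_rels_def by blast
  then have "el (tensor_rels I R) (comm (gen (i, g)) (gen (j, h))) = 0"
    by (rule el_rel)
  then show ?thesis by (simp add: el_comm)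
qed

lemma alg_hom_exists:
  assumes "\<And>r. r \<in> R \<Longrightarrow> el S (subst f r) = 0"
  shows "\<exists>h. alg_hom_on_gens R S f h"
proof -
  \<comment> \<open>The chosen representative does not matter, by
    \<open>el_subst_cong\<close>.\<close>
  define h where "h a = cls S (subst f (SOME p. cls R p = a))" for a
  have h: "h (cls R p) = cls S (subst f p)" for p
  proof -
    have "cls R (SOME p'. cls R p' = cls R p) = cls R p"
      by (rule someI[of "\<lambda>p'. cls R p' = cls R p"]) (rule refl)
    then have "el S (subst f (SOME p'. cls R p' = cls R p)) = el S (subst f p)"
      unfolding el_eq_iff[symmetric] using assms by (rule el_subst_cong[rotated])
    then show ?thesis
      by (simp only: h_def el_eq_iff)
  qed
  then have "h \<in> ring_hom (presented R) (presented S)"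
    by (rule ring_hom_presentedI) (simp_all add: subst_simps)
  with h show ?thesis
    by (auto simp: alg_hom_on_gens_def)
qed

lemma alg_hom_on_gens_comp:
  assumes "alg_hom_on_gens R S f h" "alg_hom_on_gens S T g k"
    and "\<And>x. el T (subst g (f x)) = el T (e x)"
  shows "alg_hom_on_gens R T e (k \<circ> h)"
proof -
  have "(k \<circ> h) (cls R p) = cls T (subst e p)" for p
    using assms(1,2) el_subst_eqI[OF assms(3), where p = p]
    by (simp add: alg_hom_on_gens_def subst_subst el_eq_iff)
  moreover have "k \<circ> h \<in> ring_hom (presented R) (presented T)"
    using assms(1,2) unfolding alg_hom_on_gens_def by (blast intro: ring_hom_trans)
  ultimately show ?thesis
    by (simp add: alg_hom_on_gens_def)
qed

text \<open>The inverse is the homomorphism \<open>k\<close> induced by \<open>g\<close>; both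
  composites are substitutions that fix every generator up to the relations.\<close>

lemma alg_hom_on_gens_iso:
  assumes h: "alg_hom_on_gens R S f h"
    and g: "\<And>r. r \<in> S \<Longrightarrow> el R (subst g r) = 0"
    and gf: "\<And>x. el R (subst g (f x)) = el R (gen x)"
    and fg: "\<And>y. el S (subst f (g y)) = el S (gen y)"
  shows "h \<in> ring_iso (presented R) (presented S)"
proof -
  obtain k where k: "alg_hom_on_gens S R g k"
    using alg_hom_exists[of S R g] g by blast
  have "k (h (cls R p)) = cls R p" for p
    using h k el_eq_subst_id[of R "\<lambda>x. subst g (f x)" p] gf
    by (simp add: alg_hom_on_gens_def subst_subst el_eq_iff)
  moreover have "h (k (cls S p)) = cls S p" for p
    using h k el_eq_subst_id[of S "\<lambda>y. subst f (g y)" p] fg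
    by (simp add: alg_hom_on_gens_def subst_subst el_eq_iff)
  moreover have "k (cls S p) \<in> range (cls R)" "h (cls R p') \<in> range (cls S)" for p p'
    using h k by (auto simp: alg_hom_on_gens_def)
  ultimately have "bij_betw h (range (cls R)) (range (cls S))"
    by (intro bij_betwI[where g = k]) auto
  then show ?thesis
    using h by (simp add: alg_hom_on_gens_def ring_iso_def carrier_presented)
qed

section \<open>The deformation parameter\<close>

text \<open>Monomials are kept associated to the right, where a rule for \<open>a * b\<close> does
  not match inside \<open>a * (b * z)\<close>. This gives each rule its second form.\<close>

lemma mult_eq_extend: "a * b = c \<Longrightarrow> a * (b * z) = c * z" for a b c z :: "'a::semigroup_mult"
  by (simp flip: mult.assoc)

locale deformation =
  fixes q :: complex
  assumes norm_q: "0 < norm q" "norm q < 1"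
begin

text \<open>Positive powers of q lie strictly inside the unit disc. The cases \<open>c = 1\<close>
  and \<open>c = -1\<close> with \<open>n\<close> at most 2 provide all denominators of
  \<open>q_nonzero\<close>.\<close>

lemma q_power_neq:
  assumes "norm c = 1" "n > 0"
  shows "q ^ n \<noteq> c"
proof
  assume "q ^ n = c"
  then have "norm q ^ n = 1" using assms by (metis norm_power)
  moreover have "norm q ^ n < 1" using norm_q assms(2) by (simp add: power_less_one_iff)
  ultimately show False by simp
qed

lemma q_nonzero: "q \<noteq> 0" "1 - q \<noteq> 0" "q - 1 \<noteq> 0" "1 + q \<noteq> 0" "q + 1 \<noteq> 0" "q\<^sup>2 - 1 \<noteq> 0"
  "1 - q\<^sup>2 \<noteq> 0" "q\<^sup>2 + 1 \<noteq> 0" "1 + q\<^sup>2 \<noteq> 0" "q - 1 / q \<noteq> 0"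
proof -
  show 0: "q \<noteq> 0" using norm_q by auto
  have *: "q \<noteq> 1" "q \<noteq> -1" "q\<^sup>2 \<noteq> 1" "q\<^sup>2 \<noteq> -1"
    using q_power_neq[of 1 1] q_power_neq[of "-1" 1] q_power_neq[of 1 2] q_power_neq[of "-1" 2]
    by simp_all
  then show "1 - q \<noteq> 0" "q - 1 \<noteq> 0" "q\<^sup>2 - 1 \<noteq> 0" "1 - q\<^sup>2 \<noteq> 0"
    by simp_all
  show "1 + q \<noteq> 0" "1 + q\<^sup>2 \<noteq> 0"
    using * by (simp_all add: add_eq_0_iff)
  then show "q + 1 \<noteq> 0" "q\<^sup>2 + 1 \<noteq> 0"
    by (simp_all add: add.commute)
  show "q - 1 / q \<noteq> 0"
    using *(3) 0 by (simp add: field_simps power2_eq_square)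
qed

lemma qpow_add: "qpow q (s + t) = qpow q s * qpow q t"
  by (simp add: qpow_def powr_add)

lemma qpow_0 [simp]: "qpow q 0 = 1"
  using q_nonzero by (simp add: qpow_def)

lemma qpow_1 [simp]: "qpow q 1 = q"
  using q_nonzero by (simp add: qpow_def)

lemma qpow_nonzero [simp]: "qpow q s \<noteq> 0"
  using q_nonzero by (simp add: qpow_def)

lemma qpow_minus: "qpow q (- s) = 1 / qpow q s"
  using qpow_add[of "- s" s] by (simp add: field_simps)

lemma qpow_numeral [simp]: "qpow q (numeral n) = q ^ numeral n"
  using q_nonzero by (simp add: qpow_def)

lemma qpow_half: "qpow q (1/2) = (qpow q (1/4))\<^sup>2"
  using qpow_add[of "1/4" "1/4"] by (simp add: power2_eq_square)

lemma qpow_quarter_4: "(qpow q (1/4)) ^ 4 = q"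
proof -
  have "(qpow q (1/4)) ^ 4 = qpow q (1/2) * qpow q (1/2)"
    unfolding qpow_half by (simp flip: power_add)
  also have "\<dots> = q"
    by (simp flip: qpow_add)
  finally show ?thesis .
qed

end

section \<open>The tensor square of the quantum algebra\<close>

text \<open>Keeps the index of the first tensor factor in the form \<open>1\<close>.\<close>

declare One_nat_def [simp del]

lemma coproduct_1: "coproduct 1 x = subst (coproduct_gen 1 2) x"
  by (simp add: One_nat_def numeral_2_eq_2 subst_subst subst_gen)

lemma el_tensor_rel:
  "i \<in> I \<Longrightarrow> r \<in> R \<Longrightarrow> el (tensor_rels I R) (subst (\<lambda>g. gen (i, g)) r) = 0"
  by (rule el_rel) (auto simp: tensor_rels_def)

definition higgs_to_uq :: "complex \<Rightarrow> higgs \<Rightarrow> (nat \<times> uq) free_algebra"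
  where "higgs_to_uq q g = (case g of
      HMp \<Rightarrow> scal ((two_sqrtq q)\<^sup>2) * gen (1, Jp) * gen (2, Jm)
    | HMm \<Rightarrow> scal ((two_sqrtq q)\<^sup>2) * gen (1, Jm) * gen (2, Jp)
    | HX \<Rightarrow> gen (1, QJ 1) * gen (2, QJ (- 1))
    | HXinv \<Rightarrow> gen (1, QJ (- 1)) * gen (2, QJ 1)
    | HLL12 \<Rightarrow> scal ((1 + q)\<^sup>2) * C1 q - 1
    | HLL34 \<Rightarrow> scal ((1 + q)\<^sup>2) * C2 q - 1
    | HQ s \<Rightarrow> gen (1, QJ (2 * s)) * gen (2, QJ (2 * s)))"

text \<open>The relator of [M_+, M_-] is split off so that \<open>HH_commutator\<close> can compare
  it with the second Askey-Wilson relator while neither is forced to vanish.\<close>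

definition higgs_weight_rels :: "complex \<Rightarrow> higgs free_algebra set"
  where "higgs_weight_rels q =
    {gen HX * gen HXinv - 1, gen HXinv * gen HX - 1,
     gen HX * gen HMp - scal (q^2) * gen HMp * gen HX,
     gen HX * gen HMm - scal (1 / q^2) * gen HMm * gen HX}
    \<union> one_param_rels (\<lambda>s. gen (HQ s))
    \<union> {comm (gen c) (gen g) | c g. c \<in> {HLL12, HLL34} \<union> range HQ}"

definition higgs_commutator_rel :: "complex \<Rightarrow> higgs free_algebra"
  where "higgs_commutator_rel q = (
    let mp = gen HMp; mm = gen HMm; x = gen HX; y = gen HXinv;
        l12 = gen HLL12; l34 = gen HLL34; h = (\<lambda>s. gen (HQ s))
    in
     comm mp mm -
      (scal ((1 + q) / (q * (1 - q)^3)) * h 1 *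
         (scal (q + 1/q) * (x^2 - y^2) - 2 * (h (1/2) + h (- 1/2)) * (x - y))
       + scal ((1 + q) / (q^2 * (1 - q))) * h 1 *
         ((h (- 1/2) * l12 + h (1/2) * l34) * x - (h (1/2) * l12 + h (- 1/2) * l34) * y)))"

lemma higgs_rels_eq: "higgs_rels q = insert (higgs_commutator_rel q) (higgs_weight_rels q)"
  unfolding higgs_rels_def higgs_weight_rels_def higgs_commutator_rel_def Let_def by blast

lemma higgs_weight_relsI:
  "gen HX * gen HXinv - 1 \<in> higgs_weight_rels q"
  "gen HXinv * gen HX - 1 \<in> higgs_weight_rels q"
  "gen HX * gen HMp - scal (q^2) * gen HMp * gen HX \<in> higgs_weight_rels q"
  "gen HX * gen HMm - scal (1 / q^2) * gen HMm * gen HX \<in> higgs_weight_rels q"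
  "gen (HQ 0) - 1 \<in> higgs_weight_rels q"
  "gen (HQ s) * gen (HQ t) - gen (HQ (s + t)) \<in> higgs_weight_rels q"
  "comm (gen HLL12) (gen g) \<in> higgs_weight_rels q"
  "comm (gen HLL34) (gen g) \<in> higgs_weight_rels q"
  "comm (gen (HQ s)) (gen g) \<in> higgs_weight_rels q"
  unfolding higgs_weight_rels_def one_param_rels_def by blast+

lemma higgs_weight_rels_cases:
  assumes "r \<in> higgs_weight_rels q"
    and "P (gen HX * gen HXinv - 1)"
    and "P (gen HXinv * gen HX - 1)"
    and "P (gen HX * gen HMp - scal (q^2) * gen HMp * gen HX)"
    and "P (gen HX * gen HMm - scal (1 / q^2) * gen HMm * gen HX)"
    and "P (gen (HQ 0) - 1)"
    and "\<And>s t. P (gen (HQ s) * gen (HQ t) - gen (HQ (s + t)))"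
    and "\<And>g. P (comm (gen HLL12) (gen g))"
    and "\<And>g. P (comm (gen HLL34) (gen g))"
    and "\<And>s g. P (comm (gen (HQ s)) (gen g))"
  shows "P r"
  using assms(1) unfolding higgs_weight_rels_def one_param_rels_def
  by (elim UnE insertE emptyE CollectE exE conjE rangeE) (simp_all only: assms(2-))

context deformation
begin

text \<open>This is the square of q^(1/2) (q^(1/2) + q^(-1/2)) = 1 + q.\<close>

lemma two_sqrtq_square: "q * (two_sqrtq q)\<^sup>2 = (1 + q)\<^sup>2"
proof -
  define t where "t = qpow q (1/4)"
  have t: "t \<noteq> 0" "t ^ 4 = q"
    by (simp_all add: t_def qpow_quarter_4)
  have T: "two_sqrtq q = t\<^sup>2 + 1 / t\<^sup>2"
    by (simp add: two_sqrtq_def qpow_minus qpow_half t_def)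
  have "t\<^sup>2 * (t\<^sup>2 + 1 / t\<^sup>2) = 1 + t ^ 4"
    using t(1) by (simp add: distrib_left flip: power_add)
  then have "t ^ 4 * (t\<^sup>2 + 1 / t\<^sup>2)\<^sup>2 = (1 + t ^ 4)\<^sup>2"
    by (metis (no_types, lifting) power_mult_distrib power_mult[of t 2 2] num_double numeral_times_numeral)
  then show ?thesis
    unfolding T t(2) .
qed

lemma two_sqrtq_nonzero: "two_sqrtq q \<noteq> 0"
  using two_sqrtq_square q_nonzero by auto

section \<open>Normal ordering in the tensor square\<close>

abbreviation "UU \<equiv> el (tensor_rels {1, 2 :: nat} (uq_rels q))"

lemma uq_relsI:
  "comm (gen J0) (gen Jp) - gen Jp \<in> uq_rels q"
  "comm (gen J0) (gen Jm) + gen Jm \<in> uq_rels q"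
  "gen Jm * gen Jp - scal (q^2) * gen Jp * gen Jm
    - gen (QJ 2) * qbracket q (\<lambda>s. gen (QJ (2 * s))) \<in> uq_rels q"
  "gen (QJ 0) - 1 \<in> uq_rels q"
  "gen (QJ s) * gen (QJ t) - gen (QJ (s + t)) \<in> uq_rels q"
  "comm (gen (QJ s)) (gen J0) \<in> uq_rels q"
  "gen (QJ s) * gen Jp - scal (qpow q (s * 1)) * gen Jp * gen (QJ s) \<in> uq_rels q"
  "gen (QJ s) * gen Jm - scal (qpow q (s * - 1)) * gen Jm * gen (QJ s) \<in> uq_rels q"
  unfolding uq_rels_def one_param_rels_def weight_rels_def by blast+

lemma uq_rels_cases:
  assumes "r \<in> uq_rels q"
    and "P (comm (gen J0) (gen Jp) - gen Jp)"
    and "P (comm (gen J0) (gen Jm) + gen Jm)"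
    and "P (gen Jm * gen Jp - scal (q^2) * gen Jp * gen Jm
      - gen (QJ 2) * qbracket q (\<lambda>s. gen (QJ (2 * s))))"
    and "P (gen (QJ 0) - 1)"
    and "\<And>s t. P (gen (QJ s) * gen (QJ t) - gen (QJ (s + t)))"
    and "\<And>s. P (comm (gen (QJ s)) (gen J0))"
    and "\<And>s. P (gen (QJ s) * gen Jp - scal (qpow q (s * 1)) * gen Jp * gen (QJ s))"
    and "\<And>s. P (gen (QJ s) * gen Jm - scal (qpow q (s * - 1)) * gen Jm * gen (QJ s))"
  shows "P r"
  using assms(1) unfolding uq_rels_def one_param_rels_def weight_rels_def
  by (elim UnE insertE emptyE CollectE exE conjE) (simp_all only: assms(2-))

text \<open>Read from left to right, the rules produce the order J_+, J_-, J_0, powers of q^(J_0).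
  In the third one, q^(2 J_0) [2 J_0]_q has been expanded to (q^(4 J_0) - 1) / (q - 1/q).\<close>

lemma uq_rules:
  assumes "i \<in> {1, 2}"
  shows "UU (gen (i, J0)) * UU (gen (i, Jp)) = UU (gen (i, Jp)) * UU (gen (i, J0)) + UU (gen (i, Jp))"
    and "UU (gen (i, J0)) * UU (gen (i, Jm)) = UU (gen (i, Jm)) * UU (gen (i, J0)) - UU (gen (i, Jm))"
    and "UU (gen (i, Jm)) * UU (gen (i, Jp)) = cscale (q\<^sup>2) (UU (gen (i, Jp)) * UU (gen (i, Jm)))
      + cscale (1 / (q - 1/q)) (UU (gen (i, QJ 4)) - UU 1)"
    and "UU (gen (i, QJ s)) * UU (gen (i, QJ t)) = UU (gen (i, QJ (s + t)))"
    and "UU (gen (i, QJ s)) * UU (gen (i, J0)) = UU (gen (i, J0)) * UU (gen (i, QJ s))"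
    and "UU (gen (i, QJ s)) * UU (gen (i, Jp)) = cscale (qpow q s) (UU (gen (i, Jp)) * UU (gen (i, QJ s)))"
    and "UU (gen (i, QJ s)) * UU (gen (i, Jm)) = cscale (1 / qpow q s) (UU (gen (i, Jm)) * UU (gen (i, QJ s)))"
    and "UU (gen (i, QJ 0)) = UU 1"
proof -
  note rel = uq_relsI[THEN el_tensor_rel[OF assms]]
  show "UU (gen (i, J0)) * UU (gen (i, Jp)) = UU (gen (i, Jp)) * UU (gen (i, J0)) + UU (gen (i, Jp))"
    using rel(1) by (simp add: subst_simps el_simps algebra_simps)
  show "UU (gen (i, J0)) * UU (gen (i, Jm)) = UU (gen (i, Jm)) * UU (gen (i, J0)) - UU (gen (i, Jm))"
    using rel(2) by (simp add: subst_simps el_simps algebra_simps)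
  show q0: "UU (gen (i, QJ 0)) = UU 1"
    using rel(4) by (simp add: subst_simps el_simps)
  show qq: "UU (gen (i, QJ s)) * UU (gen (i, QJ t)) = UU (gen (i, QJ (s + t)))" for s t
    using rel(5)[of s t] by (simp add: subst_simps el_simps)
  show "UU (gen (i, QJ s)) * UU (gen (i, J0)) = UU (gen (i, J0)) * UU (gen (i, QJ s))"
    using rel(6)[of s] by (simp add: subst_simps el_simps)
  show "UU (gen (i, QJ s)) * UU (gen (i, Jp)) = cscale (qpow q s) (UU (gen (i, Jp)) * UU (gen (i, QJ s)))"
    using rel(7)[of s] by (simp add: subst_simps el_simps cscale_mult)
  show "UU (gen (i, QJ s)) * UU (gen (i, Jm)) = cscale (1 / qpow q s) (UU (gen (i, Jm)) * UU (gen (i, QJ s)))"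
    using rel(8)[of s] by (simp add: subst_simps el_simps cscale_mult qpow_minus)
  show "UU (gen (i, Jm)) * UU (gen (i, Jp)) = cscale (q\<^sup>2) (UU (gen (i, Jp)) * UU (gen (i, Jm)))
      + cscale (1 / (q - 1/q)) (UU (gen (i, QJ 4)) - UU 1)"
    using rel(3) by (simp add: qbracket_def subst_simps el_simps expand_simps qq q0
        presented_prod.scale_right_diff_distrib algebra_simps)
qed

lemmas uq_rules_1 = uq_rules[of 1, OF insertI1]
lemmas uq_rules_2 = uq_rules[of 2, OF insertI2[OF insertI1]]

lemma uq_cross: "UU (gen (2, g)) * UU (gen (1, h)) = UU (gen (1, h)) * UU (gen (2, g))"
  by (rule tensor_rels_el_commute) auto

lemmas UU_rules = uq_rules_1 uq_rules_2 uq_cross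
  uq_rules_1(1-7)[THEN mult_eq_extend] uq_rules_2(1-7)[THEN mult_eq_extend] uq_cross[THEN mult_eq_extend]

lemmas UU_calc = subst_simps el_simps expand_simps UU_rules coord_simps

lemma coproduct_respects_uq_rels:
  assumes "r \<in> uq_rels q"
  shows "UU (subst (coproduct_gen 1 2) r) = 0"
  using assms
proof (rule uq_rels_cases)
  let ?s = "\<lambda>r. UU (subst (coproduct_gen 1 2) r) = 0"
  show "?s (comm (gen J0) (gen Jp) - gen Jp)"
    by (rule eq_by_coords) (simp add: UU_calc algebra_simps)
  show "?s (comm (gen J0) (gen Jm) + gen Jm)"
    by (rule eq_by_coords) (simp add: UU_calc algebra_simps)
  show "?s (gen Jm * gen Jp - scal (q^2) * gen Jp * gen Jm
       - gen (QJ 2) * qbracket q (\<lambda>s. gen (QJ (2 * s))))"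
    by (rule eq_by_coords) (simp add: qbracket_def UU_calc qpow_minus, simp add: field_simps q_nonzero)
  show "?s (gen (QJ 0) - 1)"
    by (rule eq_by_coords) (simp add: UU_calc)
  show "?s (gen (QJ s) * gen (QJ t) - gen (QJ (s + t)))" for s t
    by (rule eq_by_coords) (simp add: UU_calc)
  show "?s (comm (gen (QJ s)) (gen J0))" for s
    by (rule eq_by_coords) (simp add: UU_calc algebra_simps)
  show "?s (gen (QJ s) * gen Jp - scal (qpow q (s * 1)) * gen Jp * gen (QJ s))" for s
    by (rule eq_by_coords) (simp add: UU_calc algebra_simps)
  show "?s (gen (QJ s) * gen Jm - scal (qpow q (s * - 1)) * gen Jm * gen (QJ s))" for s
    by (rule eq_by_coords) (simp add: UU_calc algebra_simps qpow_minus)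
qed

lemma two_sqrtq_square': "(two_sqrtq q)\<^sup>2 = (1 + q)\<^sup>2 / q"
  using two_sqrtq_square q_nonzero by (simp add: field_simps)

text \<open>
  Partial fractions: every rational function that occurs below has poles at most at \<open>0\<close> and
  \<open>\<plusminus>1\<close>, and the rules below bring its coefficients to a normal form in \<open>q\<close>, \<open>1 / q\<close> and \<open>1 / (1 - q\<^sup>2)\<close>.
\<close>

definition "qinv = 1 / q"

definition "qpole = 1 / (1 - q\<^sup>2)"

lemma one_minus_q_square: "1 - q\<^sup>2 = (1 - q) * (1 + q)"
  by (simp only: distrib_left left_diff_distrib power2_eq_square) simp

lemma partial_fractions_divide:
  "c / q = c * qinv" "c / q ^ n = c * qinv ^ n" "c / qinv = c * q" "c / qinv ^ n = c * q ^ n"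
  "c / (q * x) = c * qinv / x" "c / (q ^ n * x) = c * qinv ^ n / x"
  "c / (1 - q) = c * ((1 + q) * qpole)" "c / (1 - q) ^ n = c * ((1 + q) * qpole) ^ n"
  "c / (1 + q) = c * ((1 - q) * qpole)" "c / (1 + q) ^ n = c * ((1 - q) * qpole) ^ n"
  "c / (q\<^sup>2 - 1) = c * - qpole" "c / (q\<^sup>2 - 1) ^ n = c * (- qpole) ^ n"
  "c / (q - qinv) = c * - (q * qpole)" "c / (q - qinv) ^ n = c * (- (q * qpole)) ^ n"
proof -
  show "c / q = c * qinv" "c / q ^ n = c * qinv ^ n" "c / qinv = c * q" "c / qinv ^ n = c * q ^ n"
    "c / (q * x) = c * qinv / x" "c / (q ^ n * x) = c * qinv ^ n / x"
    by (simp_all add: qinv_def power_divide)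
  have "1 / (1 - q) = (1 + q) * qpole" "1 / (1 + q) = (1 - q) * qpole"
    using q_nonzero unfolding qpole_def one_minus_q_square by simp_all
  moreover have m: "1 / (q\<^sup>2 - 1) = - qpole"
    unfolding qpole_def by (metis minus_diff_eq minus_divide_right)
  moreover have "q - qinv = (q\<^sup>2 - 1) / q"
    using q_nonzero by (simp add: qinv_def diff_divide_distrib power2_eq_square)
  then have "1 / (q - qinv) = - (q * qpole)"
    using m by (simp add: divide_inverse)
  moreover have "c / x = c * y" "c / x ^ n = c * y ^ n" if "1 / x = y" for x y
    using that by (auto simp: power_divide)
  ultimately show "c / (1 - q) = c * ((1 + q) * qpole)" "c / (1 - q) ^ n = c * ((1 + q) * qpole) ^ n"
    "c / (1 + q) = c * ((1 - q) * qpole)" "c / (1 + q) ^ n = c * ((1 - q) * qpole) ^ n"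
    "c / (q\<^sup>2 - 1) = c * - qpole" "c / (q\<^sup>2 - 1) ^ n = c * (- qpole) ^ n"
    "c / (q - qinv) = c * - (q * qpole)" "c / (q - qinv) ^ n = c * (- (q * qpole)) ^ n"
    by blast+
qed

text \<open>Repeated use leaves only \<open>q ^ a\<close>, \<open>qinv ^ b\<close>,
  \<open>qpole ^ c\<close> and \<open>q * qpole ^ c\<close>, which are linearly independent as
  rational functions of q, so that both sides of an identity take the same shape.\<close>

lemma partial_fractions:
  "q * qinv = 1" "q * (qinv * x) = x"
  "q * (q * qpole) = qpole - 1" "q * (q * (qpole * x)) = qpole * x - x"
  "qinv * qpole = q * qpole + qinv" "qinv * (qpole * x) = q * (qpole * x) + qinv * x"
proof -
  show 1: "q * qinv = 1" "q * (qinv * x) = x" for x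
    using q_nonzero by (simp_all add: qinv_def)
  have "(1 - q\<^sup>2) * qpole = 1"
    using q_nonzero by (simp add: qpole_def)
  then show 2: "q * (q * qpole) = qpole - 1"
    by (simp add: algebra_simps power2_eq_square)
  then show "q * (q * (qpole * x)) = qpole * x - x" for x
    by (metis left_diff_distrib mult.assoc mult_1)
  have "q * (qinv * qpole) = q * (q * qpole + qinv)"
    by (simp add: 1 2 distrib_left)
  then show 3: "qinv * qpole = q * qpole + qinv"
    using q_nonzero by simp
  then show "qinv * (qpole * x) = q * (qpole * x) + qinv * x" for x
    by (metis distrib_right mult.assoc)
qed

lemma qpow_uminus_numeral: "qpow q (- 1) = qinv" "qpow q (- numeral n) = qinv ^ numeral n"
  by (simp_all add: qpow_minus qinv_def power_divide)

lemmas coefficient_simps = partial_fractions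
  power2_eq_square power3_eq_cube power4_eq_xxxx algebra_simps add_divide_distrib diff_divide_distrib

text \<open>These only match denominators to which distributivity has not yet been applied.\<close>

lemma divide_numeral_mult: "c / (numeral n * x) = c / numeral n / (x :: complex)"
  by simp

lemmas clear_denominators = partial_fractions_divide divide_numeral_mult

lemmas scalar_simps = q_nonzero(1) qpow_uminus_numeral partial_fractions_divide

section \<open>Casimir elements and the Higgs relations in the tensor square\<close>

lemma casimir_central:
  assumes i: "i \<in> {1, 2}"
  shows "UU (gen (i, g)) * UU (subst (\<lambda>g. gen (i, g)) (casimir q)) =
    UU (subst (\<lambda>g. gen (i, g)) (casimir q)) * UU (gen (i, g))"
proof (rule eq_by_coords)
  note rules = uq_rules[OF i] uq_rules(1-7)[OF i, THEN mult_eq_extend]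
  show "coord z (UU (gen (i, g)) * UU (subst (\<lambda>g. gen (i, g)) (casimir q))) =
    coord z (UU (subst (\<lambda>g. gen (i, g)) (casimir q)) * UU (gen (i, g)))" for z
  proof (cases g)
    case J0
    then show ?thesis
      by (simp add: casimir_def subst_simps el_simps expand_simps rules scalar_simps)
  next
    case Jp
    then show ?thesis
      by (simp add: casimir_def subst_simps el_simps expand_simps rules scalar_simps)
        (simp add: coord_simps scalar_simps, simp add: coefficient_simps)
  next
    case Jm
    then show ?thesis
      by (simp add: casimir_def subst_simps el_simps expand_simps rules scalar_simps)
        (simp add: coord_simps scalar_simps, simp add: coefficient_simps)
  next
    case (QJ s)
    then show ?thesis
      by (simp add: casimir_def subst_simps el_simps expand_simps rules add.commute)
  qed
qed

lemma UU_C1_commute: "UU (gen (1, g)) * UU (C1 q) = UU (C1 q) * UU (gen (1, g))"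
  "UU (gen (2, g)) * UU (C1 q) = UU (C1 q) * UU (gen (2, g))"
proof -
  show "UU (gen (1, g)) * UU (C1 q) = UU (C1 q) * UU (gen (1, g))"
    unfolding C1_def by (rule casimir_central) simp
  show "UU (gen (2, g)) * UU (C1 q) = UU (C1 q) * UU (gen (2, g))"
    unfolding C1_def by (rule el_commute_subst) (rule uq_cross)
qed

lemma UU_C2_commute: "UU (gen (1, g)) * UU (C2 q) = UU (C2 q) * UU (gen (1, g))"
  "UU (gen (2, g)) * UU (C2 q) = UU (C2 q) * UU (gen (2, g))"
proof -
  show "UU (gen (1, g)) * UU (C2 q) = UU (C2 q) * UU (gen (1, g))"
    unfolding C2_def by (rule el_commute_subst) (rule uq_cross[symmetric])
  show "UU (gen (2, g)) * UU (C2 q) = UU (C2 q) * UU (gen (2, g))"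
    unfolding C2_def by (rule casimir_central) simp
qed

lemma UU_C_commute: "UU (C2 q) * UU (C1 q) = UU (C1 q) * UU (C2 q)"
  unfolding C1_def by (rule el_commute_subst) (rule UU_C2_commute(1)[symmetric])

lemmas UU_C_rules = UU_C1_commute UU_C2_commute UU_C_commute
  UU_C1_commute[THEN mult_eq_extend] UU_C2_commute[THEN mult_eq_extend]
  UU_C_commute[THEN mult_eq_extend]

lemmas UU_norm = subst_simps el_simps expand_simps UU_rules scalar_simps

lemmas realization_simps = higgs_to_uq_def C1_def C2_def casimir_def higgs_C1_def higgs_C2_def
  two_sqrtq_square'

lemma UU_higgs_weight_rels:
  assumes "r \<in> higgs_weight_rels q"
  shows "UU (subst (higgs_to_uq q) r) = 0"
  using assms
proof (rule higgs_weight_rels_cases)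
  let ?s = "\<lambda>r. UU (subst (higgs_to_uq q) r) = 0"
  show "?s (gen HX * gen HXinv - 1)" "?s (gen HXinv * gen HX - 1)"
    by (rule eq_by_coords, simp add: realization_simps UU_norm coord_simps)+
  show "?s (gen HX * gen HMp - scal (q^2) * gen HMp * gen HX)"
    by (rule eq_by_coords) (simp add: realization_simps UU_norm,
        simp add: coord_simps scalar_simps, simp add: coefficient_simps)
  show "?s (gen HX * gen HMm - scal (1 / q^2) * gen HMm * gen HX)"
    by (rule eq_by_coords) (simp add: realization_simps UU_norm,
        simp add: coord_simps scalar_simps, simp add: coefficient_simps)
  show "?s (gen (HQ 0) - 1)"
    by (rule eq_by_coords) (simp add: realization_simps UU_norm coord_simps)
  show "?s (gen (HQ s) * gen (HQ t) - gen (HQ (s + t)))" for s t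
    by (rule eq_by_coords) (simp add: realization_simps UU_norm coord_simps)
  show "?s (comm (gen (HQ s)) (gen g))" for s g
    by (cases g; simp add: higgs_to_uq_def UU_norm UU_C_rules; simp only: add.commute)
  show "?s (comm (gen HLL12) (gen g))" for g
    by (cases g; simp add: higgs_to_uq_def UU_norm UU_C_rules; simp add: algebra_simps)
  show "?s (comm (gen HLL34) (gen g))" for g
    by (cases g; simp add: higgs_to_uq_def UU_norm UU_C_rules; simp add: algebra_simps)
qed

text \<open>The Casimir element gives J_+ J_- = (C + f) q^(2 J_0 - 1) and J_- J_+ = (C + g) q^(2 J_0
  + 1) with f, g functions of q^(J_0). In the commutator of J_+ tensor J_- and J_- tensor J_+ the
  products of the two Casimir elements cancel, which is why the relation is linear in the squares of
  the structure constants.\<close>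

lemma UU_higgs_commutator_rel: "UU (subst (higgs_to_uq q) (higgs_commutator_rel q)) = 0"
  by (rule eq_by_coords,
      simp only: higgs_commutator_rel_def Let_def realization_simps clear_denominators,
      simp add: realization_simps higgs_commutator_rel_def Let_def UU_norm,
      simp add: coord_simps scalar_simps,
      simp add: coefficient_simps)

lemma UU_K1: "UU (subst (higgs_to_uq q) (aw_to_higgs q AK1)) = UU (K1 q)"
  by (rule eq_by_coords) (simp add: realization_simps K1_def UU_norm)

lemma UU_K2: "UU (subst (higgs_to_uq q) (aw_to_higgs q AK2)) = UU (K2 q)"
  by (rule eq_by_coords,
      simp only: realization_simps aw_to_higgs.simps K1_def K2_def K3_def clear_denominators,
      simp add: realization_simps K2_def coproduct_1 UU_norm,
      simp add: coord_simps scalar_simps,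
      simp add: coefficient_simps)

lemma UU_K3: "UU (subst (higgs_to_uq q) (aw_to_higgs q AK3)) = UU (K3 q)"
  by (rule eq_by_coords,
      simp only: realization_simps aw_to_higgs.simps K1_def K2_def K3_def clear_denominators,
      simp add: realization_simps K1_def K2_def K3_def coproduct_1 UU_norm,
      simp add: coord_simps scalar_simps,
      simp add: coefficient_simps)

lemma UU_realizes_aw:
  assumes "g \<noteq> AK1" "g \<noteq> AK2" "g \<noteq> AK3"
  shows "UU (subst (higgs_to_uq q) (aw_to_higgs q g)) = UU (case g of
      AKinv \<Rightarrow> gen (1, QJ (- 1)) * gen (2, QJ 1)
    | AC1 \<Rightarrow> C1 q
    | AC2 \<Rightarrow> C2 q
    | AQ s \<Rightarrow> coproduct 1 (gen (QJ s)))"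
  using assms q_nonzero(4)
  by (cases g) (simp_all add: higgs_to_uq_def higgs_C1_def higgs_C2_def coproduct_1 subst_simps el_simps
      expand_simps)

end

section \<open>The oscillator realization\<close>

lemma el_commute_subst2:
  assumes "\<And>g h. el S (f g) * el S (f' h) = el S (f' h) * el S (f g)"
  shows "el S (subst f p) * el S (subst f' p') = el S (subst f' p') * el S (subst f p)"
  by (intro el_commute_subst el_commute_subst[symmetric] assms assms[symmetric])

lemma osc_relsI:
  "comm (gen A0) (gen Ap) - gen Ap \<in> osc_rels q"
  "comm (gen A0) (gen Am) + gen Am \<in> osc_rels q"
  "comm (gen Am) (gen Ap) - gen (QA 1) \<in> osc_rels q"
  "gen Am * gen Ap - scal q * gen Ap * gen Am - 1 \<in> osc_rels q"
  "gen (QA 0) - 1 \<in> osc_rels q"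
  "gen (QA s) * gen (QA t) - gen (QA (s + t)) \<in> osc_rels q"
  "comm (gen (QA s)) (gen A0) \<in> osc_rels q"
  "gen (QA s) * gen Ap - scal (qpow q (s * 1)) * gen Ap * gen (QA s) \<in> osc_rels q"
  "gen (QA s) * gen Am - scal (qpow q (s * - 1)) * gen Am * gen (QA s) \<in> osc_rels q"
  unfolding osc_rels_def one_param_rels_def weight_rels_def by blast+

definition metaplectic_at :: "complex \<Rightarrow> 4 \<Rightarrow> uq \<Rightarrow> osc4"
  where "metaplectic_at q i g = subst (\<lambda>x. gen (i, x)) (metaplectic q g)"

context deformation
begin

abbreviation "EE \<equiv> el (osc4_rels q)"

text \<open>The two relations between A^- and A^+ are linear equations for A^- A^+ and A^+ A^-.
  Solving them expresses both products by q^(A^0), so normal forms never contain A_i^+ and A_i^-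
  together.\<close>

lemma osc_rules:
  shows "EE (a_zero i) * EE (a_plus i) = EE (a_plus i) * EE (a_zero i) + EE (a_plus i)"
    and "EE (a_zero i) * EE (a_minus i) = EE (a_minus i) * EE (a_zero i) - EE (a_minus i)"
    and "EE (a_plus i) * EE (a_minus i) = cscale (1 / (1 - q)) (EE 1 - EE (q_a 1 i))"
    and "EE (a_minus i) * EE (a_plus i) = cscale (1 / (1 - q)) (EE 1 - cscale q (EE (q_a 1 i)))"
    and "EE (q_a s i) * EE (q_a t i) = EE (q_a (s + t) i)"
    and "EE (q_a s i) * EE (a_zero i) = EE (a_zero i) * EE (q_a s i)"
    and "EE (q_a s i) * EE (a_plus i) = cscale (qpow q s) (EE (a_plus i) * EE (q_a s i))"
    and "EE (q_a s i) * EE (a_minus i) = cscale (qpow q (- s)) (EE (a_minus i) * EE (q_a s i))"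
    and "EE (q_a 0 i) = EE 1"
proof -
  note rel = osc_relsI[where q = q, THEN el_tensor_rel[of i UNIV, OF UNIV_I], folded osc4_rels_def]
  show "EE (a_zero i) * EE (a_plus i) = EE (a_plus i) * EE (a_zero i) + EE (a_plus i)"
    using rel(1) by (simp add: subst_simps el_simps algebra_simps)
  show "EE (a_zero i) * EE (a_minus i) = EE (a_minus i) * EE (a_zero i) - EE (a_minus i)"
    using rel(2) by (simp add: subst_simps el_simps algebra_simps)
  have 1: "EE (a_minus i) * EE (a_plus i) = EE (a_plus i) * EE (a_minus i) + EE (q_a 1 i)"
    using rel(3) by (simp add: subst_simps el_simps algebra_simps)
  have 2: "EE (a_minus i) * EE (a_plus i) = cscale q (EE (a_plus i) * EE (a_minus i)) + EE 1"
    using rel(4) by (simp add: subst_simps el_simps expand_simps algebra_simps)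
  show 3: "EE (a_plus i) * EE (a_minus i) = cscale (1 / (1 - q)) (EE 1 - EE (q_a 1 i))"
  proof -
    have "cscale (1 - q) (EE (a_plus i) * EE (a_minus i)) = EE 1 - EE (q_a 1 i)"
      using 1 2 by (simp add: presented_prod.scale_left_diff_distrib algebra_simps)
    then have "cscale (1 / (1 - q)) (cscale (1 - q) (EE (a_plus i) * EE (a_minus i)))
      = cscale (1 / (1 - q)) (EE 1 - EE (q_a 1 i))"
      by simp
    then show ?thesis
      using q_nonzero(2) by simp
  qed
  show "EE (a_minus i) * EE (a_plus i) = cscale (1 / (1 - q)) (EE 1 - cscale q (EE (q_a 1 i)))"
    unfolding 2 3
    by (rule eq_by_coords) (simp add: coord_simps scalar_simps, simp add: coefficient_simps)
  show "EE (q_a 0 i) = EE 1"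
    using rel(5) by (simp add: subst_simps el_simps)
  show "EE (q_a s i) * EE (q_a t i) = EE (q_a (s + t) i)"
    using rel(6)[of s t] by (simp add: subst_simps el_simps)
  show "EE (q_a s i) * EE (a_zero i) = EE (a_zero i) * EE (q_a s i)"
    using rel(7)[of s] by (simp add: subst_simps el_simps)
  show "EE (q_a s i) * EE (a_plus i) = cscale (qpow q s) (EE (a_plus i) * EE (q_a s i))"
    using rel(8)[of s] by (simp add: subst_simps el_simps cscale_mult)
  show "EE (q_a s i) * EE (a_minus i) = cscale (qpow q (- s)) (EE (a_minus i) * EE (q_a s i))"
    using rel(9)[of s] by (simp add: subst_simps el_simps cscale_mult)
qed

lemma osc_cross: "i \<noteq> j \<Longrightarrow> EE (gen (i, g)) * EE (gen (j, h)) = EE (gen (j, h)) * EE (gen (i, g))"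
  unfolding osc4_rels_def by (rule tensor_rels_el_commute) auto

lemmas EE_rules = osc_rules osc_rules(1-8)[THEN mult_eq_extend]

lemmas EE_norm = subst_simps el_simps expand_simps presented_prod.scale_right_distrib
  presented_prod.scale_right_diff_distrib EE_rules

subsection \<open>The metaplectic representation\<close>

definition "qroot = qpow q (1/4)"

text \<open>Negative fractional powers of q are written with \<open>qinv\<close>, so only
  nonnegative powers of \<open>qroot\<close> occur, and fourth powers reduce to q.\<close>

lemma qroot_rules:
  "qpow q (1/4) = qroot" "qpow q (- (1/4)) = qinv * qroot ^ 3"
  "qpow q (1/2) = qroot\<^sup>2" "qpow q (- (1/2)) = qinv * qroot\<^sup>2"
  "qroot * (qroot * (qroot * qroot)) = q" "qroot * (qroot * (qroot * (qroot * x))) = q * x"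
proof -
  have r: "qroot ^ 4 = q"
    by (simp add: qroot_def qpow_quarter_4)
  then show 1: "qroot * (qroot * (qroot * qroot)) = q" "qroot * (qroot * (qroot * (qroot * x))) = q * x" for x
    by (simp_all add: power4_eq_xxxx mult.assoc)
  show "qpow q (1/4) = qroot" "qpow q (1/2) = qroot\<^sup>2"
    by (simp_all add: qroot_def qpow_half)
  have nz: "qroot \<noteq> 0"
    by (simp add: qroot_def)
  have "(qinv * qroot ^ 3) * qroot = qinv * qroot ^ 4" "(qinv * qroot\<^sup>2) * qroot\<^sup>2 = qinv * qroot ^ 4"
    by (simp_all add: power2_eq_square power3_eq_cube power4_eq_xxxx)
  moreover have "qinv * qroot ^ 4 = 1"
    using r partial_fractions(1) by (simp add: mult.commute)
  ultimately have "1 / qroot = qinv * qroot ^ 3" "1 / qroot\<^sup>2 = qinv * qroot\<^sup>2"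
    using nz by (simp_all only: nonzero_divide_eq_eq power_not_zero not_False_eq_True)
  then show "qpow q (- (1/4)) = qinv * qroot ^ 3" "qpow q (- (1/2)) = qinv * qroot\<^sup>2"
    unfolding qpow_minus by (simp_all add: qroot_def qpow_half)
qed

lemma divide_two_sqrtq:
  "c / (two_sqrtq q * two_sqrtq q) = c * (q * ((1 - q) * qpole)\<^sup>2)"
  "c / (two_sqrtq q)\<^sup>2 = c * (q * ((1 - q) * qpole)\<^sup>2)"
proof -
  have "1 / (two_sqrtq q)\<^sup>2 = q / (1 + q)\<^sup>2"
    by (simp add: two_sqrtq_square')
  also have "\<dots> = q * ((1 - q) * qpole)\<^sup>2"
    by (rule partial_fractions_divide)
  finally show "c / (two_sqrtq q)\<^sup>2 = c * (q * ((1 - q) * qpole)\<^sup>2)"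
    by (metis mult.right_neutral times_divide_eq_right)
  then show "c / (two_sqrtq q * two_sqrtq q) = c * (q * ((1 - q) * qpole)\<^sup>2)"
    by (simp add: power2_eq_square)
qed

lemmas osc_scalar_simps = scalar_simps qroot_rules(1-4) divide_two_sqrtq

lemma metaplectic_respects_uq_rels:
  assumes "r \<in> uq_rels q"
  shows "EE (subst (metaplectic_at q i) r) = 0"
  using assms
proof (rule uq_rels_cases)
  let ?s = "\<lambda>r. EE (subst (metaplectic_at q i) r) = 0"
  note defs = metaplectic_at_def metaplectic_def
  show "?s (comm (gen J0) (gen Jp) - gen Jp)"
    by (rule eq_by_coords) (simp add: defs EE_norm, simp add: coord_simps algebra_simps add_divide_distrib)
  show "?s (comm (gen J0) (gen Jm) + gen Jm)"
    by (rule eq_by_coords) (simp add: defs EE_norm, simp add: coord_simps algebra_simps add_divide_distrib)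
  show "?s (gen Jm * gen Jp - scal (q^2) * gen Jp * gen Jm
       - gen (QJ 2) * qbracket q (\<lambda>s. gen (QJ (2 * s))))"
    by (rule eq_by_coords)
      (simp add: defs qbracket_def EE_norm osc_scalar_simps, simp add: coord_simps osc_scalar_simps,
        simp add: coefficient_simps qroot_rules divide_two_sqrtq)
  show "?s (gen (QJ 0) - 1)"
    by (rule eq_by_coords) (simp add: defs EE_norm)
  show "?s (gen (QJ s) * gen (QJ t) - gen (QJ (s + t)))" for s t
    by (rule eq_by_coords) (simp add: defs EE_norm add_divide_distrib qpow_add mult.commute)
  show "?s (comm (gen (QJ s)) (gen J0))" for s
    by (rule eq_by_coords) (simp add: defs EE_norm)
  \<comment> \<open>q^(s J_0) maps to a multiple of q^((s/2) A^0), which picks up a factor q^(s/2)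
    or its inverse from each of the two factors of (A^+)^2 or (A^-)^2.\<close>
  have half: "qpow q (s / 2) * qpow q (s / 2) = qpow q s" for s
    by (simp flip: qpow_add)
  show "?s (gen (QJ s) * gen Jp - scal (qpow q (s * 1)) * gen Jp * gen (QJ s))" for s
    by (rule eq_by_coords) (simp add: defs EE_norm half, simp add: mult_ac half)
  show "?s (gen (QJ s) * gen Jm - scal (qpow q (s * - 1)) * gen Jm * gen (QJ s))" for s
    using half[of "- s"]
    by (intro eq_by_coords) (simp add: defs EE_norm, simp add: mult_ac)
qed

end

subsection \<open>Pairs of oscillators\<close>

definition metaplectic_pair :: "complex \<Rightarrow> 4 \<Rightarrow> 4 \<Rightarrow> nat \<times> uq \<Rightarrow> osc4"
  where "metaplectic_pair q i j = (\<lambda>(n, g). metaplectic_at q (if n = 1 then i else j) g)"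

context deformation
begin

lemma metaplectic_at_commute:
  assumes "i \<noteq> j"
  shows "EE (metaplectic_at q i g) * EE (metaplectic_at q j h) =
    EE (metaplectic_at q j h) * EE (metaplectic_at q i g)"
  unfolding metaplectic_at_def using assms by (intro el_commute_subst2 osc_cross)

lemma metaplectic_pair_respects:
  assumes "i \<noteq> j" "r \<in> tensor_rels {1, 2} (uq_rels q)"
  shows "EE (subst (metaplectic_pair q i j) r) = 0"
proof (rule tensor_rels_respected[OF _ _ assms(2)])
  show "EE (subst (\<lambda>g. metaplectic_pair q i j (n, g)) r) = 0" if "r \<in> uq_rels q" for n r
    using metaplectic_respects_uq_rels[OF that] by (simp add: metaplectic_pair_def)
  show "EE (metaplectic_pair q i j (n, g)) * EE (metaplectic_pair q i j (m, h)) =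
      EE (metaplectic_pair q i j (m, h)) * EE (metaplectic_pair q i j (n, g))"
    if "n \<in> {1, 2}" "m \<in> {1, 2}" "n \<noteq> m" for n m g h
    using that assms(1) by (auto simp: metaplectic_pair_def metaplectic_at_commute)
qed

lemma metaplectic_pair_coproduct:
  assumes "i \<noteq> j"
  shows "EE (subst (metaplectic_pair q i j) (coproduct_gen 1 2 g)) = EE (pair_realization q i j g)"
proof (rule eq_by_coords)
  note cross = osc_cross[OF assms[symmetric]] osc_cross[OF assms[symmetric], THEN mult_eq_extend]
  note defs = metaplectic_pair_def metaplectic_at_def metaplectic_def pair_realization_def
  show "coord z (EE (subst (metaplectic_pair q i j) (coproduct_gen 1 2 g))) =
    coord z (EE (pair_realization q i j g))" for z
  proof (cases g)
    case (QJ s)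
    have "qpow q (s / 4) * qpow q (s / 4) = qpow q (s / 2)"
      by (simp flip: qpow_add)
    with QJ show ?thesis
      by (simp add: defs EE_norm cross)
  qed (simp_all add: defs EE_norm cross coord_simps osc_scalar_simps)
qed

lemma pair_realization_eq:
  assumes "i \<noteq> j"
  shows "EE (subst (pair_realization q i j) p) = EE (subst (metaplectic_pair q i j) (subst (coproduct_gen 1 2) p))"
  using el_subst_eqI[of "osc4_rels q" "\<lambda>g. subst (metaplectic_pair q i j) (coproduct_gen 1 2 g)"
      "pair_realization q i j" p] metaplectic_pair_coproduct[OF assms]
  by (simp add: subst_subst)

text \<open>The explicit pair formulas are the coproduct followed by two metaplectic
  representations, so the relations are inherited from those two steps.\<close>

lemma pair_realization_respects:
  assumes "i \<noteq> j" "r \<in> uq_rels q"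
  shows "EE (subst (pair_realization q i j) r) = 0"
proof -
  have "UU (subst (coproduct_gen 1 2) r) = UU 0"
    using coproduct_respects_uq_rels[OF assms(2)] by (simp add: el_0)
  then have "EE (subst (metaplectic_pair q i j) (subst (coproduct_gen 1 2) r)) =
      EE (subst (metaplectic_pair q i j) 0)"
    using metaplectic_pair_respects[OF assms(1)] by (rule el_subst_cong[rotated])
  then show ?thesis
    by (simp add: pair_realization_eq[OF assms(1)] subst_0 el_0)
qed

lemma pair_realization_commute:
  assumes "i \<noteq> j" "k \<noteq> l" "{i, j} \<inter> {k, l} = {}"
  shows "EE (pair_realization q i j g) * EE (pair_realization q k l h) =
    EE (pair_realization q k l h) * EE (pair_realization q i j g)"
  unfolding metaplectic_pair_coproduct[OF assms(1), symmetric] metaplectic_pair_coproduct[OF assms(2), symmetric]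
proof (rule el_commute_subst2)
  show "EE (metaplectic_pair q i j g) * EE (metaplectic_pair q k l h) =
    EE (metaplectic_pair q k l h) * EE (metaplectic_pair q i j g)" for g h
    using assms(3) by (cases g, cases h) (auto simp: metaplectic_pair_def intro!: metaplectic_at_commute)
qed

text \<open>Ordered rewriting may put up to three factors \<open>qroot\<close> between the factors that cancel.\<close>

lemma partial_fractions_gap:
  "q * (y * qinv) = y" "q * (y * (qinv * x)) = y * x"
  "q * (y * (z * qinv)) = y * z" "q * (y * (z * (qinv * x))) = y * (z * x)"
  "q * (y * (z * (w * qinv))) = y * (z * w)" "q * (y * (z * (w * (qinv * x)))) = y * (z * (w * x))"
  "q * (q * (y * qpole)) = y * qpole - y" "q * (q * (y * (qpole * x))) = y * (qpole * x) - y * x"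
  "q * (q * (y * (z * qpole))) = y * (z * qpole) - y * z"
  "q * (q * (y * (z * (qpole * x)))) = y * (z * (qpole * x)) - y * (z * x)"
  "q * (q * (y * (z * (w * qpole)))) = y * (z * (w * qpole)) - y * (z * w)"
  "q * (q * (y * (z * (w * (qpole * x))))) = y * (z * (w * (qpole * x))) - y * (z * (w * x))"
proof -
  have *: "q * (a * qinv * b) = a * b" "q * (q * (a * qpole * b)) = a * qpole * b - a * b" for a b
    using partial_fractions(2)[of "a * b"] partial_fractions(4)[of "a * b"]
    by (simp_all only: mult_ac)
  show "q * (y * qinv) = y" "q * (y * (qinv * x)) = y * x"
    "q * (y * (z * qinv)) = y * z" "q * (y * (z * (qinv * x))) = y * (z * x)"
    "q * (y * (z * (w * qinv))) = y * (z * w)" "q * (y * (z * (w * (qinv * x)))) = y * (z * (w * x))"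
    using *(1)[of y 1] *(1)[of y x] *(1)[of "y * z" 1] *(1)[of "y * z" x]
      *(1)[of "y * (z * w)" 1] *(1)[of "y * (z * w)" x]
    by (simp_all only: mult.assoc mult_1_right)
  show "q * (q * (y * qpole)) = y * qpole - y" "q * (q * (y * (qpole * x))) = y * (qpole * x) - y * x"
    "q * (q * (y * (z * qpole))) = y * (z * qpole) - y * z"
    "q * (q * (y * (z * (qpole * x)))) = y * (z * (qpole * x)) - y * (z * x)"
    "q * (q * (y * (z * (w * qpole)))) = y * (z * (w * qpole)) - y * (z * w)"
    "q * (q * (y * (z * (w * (qpole * x))))) = y * (z * (w * (qpole * x))) - y * (z * (w * x))"
    using *(2)[of y 1] *(2)[of y x] *(2)[of "y * z" 1] *(2)[of "y * z" x]
      *(2)[of "y * (z * w)" 1] *(2)[of "y * (z * w)" x]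
    by (simp_all only: mult.assoc mult_1_right)
qed

lemma qroot_powers:
  "qroot ^ 4 = q" "qroot ^ 5 = q * qroot" "qroot ^ 6 = q * qroot\<^sup>2" "qroot ^ 7 = q * qroot ^ 3"
  "qroot ^ 8 = q\<^sup>2"
proof -
  show 4: "qroot ^ 4 = q"
    by (simp add: qroot_def qpow_quarter_4)
  show "qroot ^ 5 = q * qroot" "qroot ^ 6 = q * qroot\<^sup>2" "qroot ^ 7 = q * qroot ^ 3" "qroot ^ 8 = q\<^sup>2"
    using power_add[of qroot 4 1] power_add[of qroot 4 2] power_add[of qroot 4 3] power_add[of qroot 4 4]
    by (simp_all add: 4 power2_eq_square)
qed

text \<open>Normal ordering of both sides in two oscillators. Keeping \<open>i\<close> and
  \<open>j\<close> arbitrary lets one computation serve both C^(1) and C^(2).\<close>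

lemma casimir_pair_realization:
  assumes "i \<noteq> j"
  shows "EE (subst (pair_realization q i j) (casimir q)) = EE (scal (1 / (1 + q)\<^sup>2) * ((oscLL q i j)\<^sup>2 + 1))"
proof (rule eq_by_coords)
  note cross = osc_cross[OF assms[symmetric]] osc_cross[OF assms[symmetric], THEN mult_eq_extend]
  show "coord z (EE (subst (pair_realization q i j) (casimir q))) =
    coord z (EE (scal (1 / (1 + q)\<^sup>2) * ((oscLL q i j)\<^sup>2 + 1)))" for z
    by (simp only: casimir_def oscLL_def clear_denominators,
        simp add: pair_realization_def EE_norm cross osc_scalar_simps,
        simp add: coord_simps osc_scalar_simps,
        simp add: coefficient_simps partial_fractions_gap qroot_rules qroot_powers divide_two_sqrtq)
qed

end

section \<open>The abstract algebras\<close>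

definition aw_X :: "complex \<Rightarrow> aw free_algebra"
  where "aw_X q = 1 - scal (4 * (1 - q)) * gen AK1"

definition aw_rhs2 :: "complex \<Rightarrow> aw free_algebra"
  where "aw_rhs2 q = scal (- ((q - 1/q)^2)) * gen AK2 * gen AK1 * gen AK2
      + scal ((1 + 1 / q^2) / 2) * acomm (gen AK1) (gen AK2)
      + scal ((1 + q)^2 * (1 - q) / (4 * q^2)) * (gen AK2)^2
      + scal (4 * (q - 1)) * aw_xi7 q * gen AK2 + scal 0 * gen AK1
      + - scal ((1 + q) * (1 + q^2) / (16 * q^3)) * (gen AC1 - gen AC2) * qbracket q (\<lambda>s. gen (AQ s))"

definition aw_rhs3 :: "complex \<Rightarrow> aw free_algebra"
  where "aw_rhs3 q = scal (- ((q - 1/q)^2)) * gen AK1 * gen AK2 * gen AK1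
      + scal ((1 + 1 / q^2) / 2) * (gen AK1)^2
      + scal ((1 + q)^2 * (1 - q) / (4 * q^2)) * acomm (gen AK1) (gen AK2)
      + scal (4 * (q - 1)) * aw_xi7 q * gen AK1
      + scal (- ((1 + q)^2 / (16 * q^2))) * gen AK2 + aw_xi7 q"

lemma aw_relsI:
  "comm (gen AK1) (gen AK2) - gen AK3 \<in> aw_rels q"
  "comm (gen AK2) (gen AK3) - aw_rhs2 q \<in> aw_rels q"
  "comm (gen AK3) (gen AK1) - aw_rhs3 q \<in> aw_rels q"
  "aw_X q * gen AKinv - 1 \<in> aw_rels q"
  "gen AKinv * aw_X q - 1 \<in> aw_rels q"
  "gen (AQ 0) - 1 \<in> aw_rels q"
  "gen (AQ s) * gen (AQ t) - gen (AQ (s + t)) \<in> aw_rels q"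
  "comm (gen AC1) (gen g) \<in> aw_rels q"
  "comm (gen AC2) (gen g) \<in> aw_rels q"
  "comm (gen (AQ s)) (gen g) \<in> aw_rels q"
  unfolding aw_rels_def one_param_rels_def Let_def aw_rhs2_def aw_rhs3_def aw_X_def by blast+

lemma aw_rels_cases:
  assumes "r \<in> aw_rels q"
    and "P (comm (gen AK1) (gen AK2) - gen AK3)"
    and "P (comm (gen AK2) (gen AK3) - aw_rhs2 q)"
    and "P (comm (gen AK3) (gen AK1) - aw_rhs3 q)"
    and "P (aw_X q * gen AKinv - 1)"
    and "P (gen AKinv * aw_X q - 1)"
    and "P (gen (AQ 0) - 1)"
    and "\<And>s t. P (gen (AQ s) * gen (AQ t) - gen (AQ (s + t)))"
    and "\<And>g. P (comm (gen AC1) (gen g))"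
    and "\<And>g. P (comm (gen AC2) (gen g))"
    and "\<And>s g. P (comm (gen (AQ s)) (gen g))"
  shows "P r"
  using assms(1) unfolding aw_rels_def one_param_rels_def Let_def
  by (elim UnE insertE emptyE CollectE exE conjE rangeE)
    (simp_all only: assms(2-) aw_rhs2_def[symmetric] aw_rhs3_def[symmetric] aw_X_def[symmetric])

definition higgs_to_aw_sum :: "complex \<Rightarrow> aw free_algebra"
  where "higgs_to_aw_sum q = scal ((1 + q)\<^sup>2 / q) *
    (2 * gen AK2 * aw_X q - (gen AC1 * gen (AQ 1) + gen AC2 * gen (AQ (- 1)))
      - scal (1 + 1 / q\<^sup>2) * scal (1 / (q - 1/q)\<^sup>2) *
        (aw_X q + gen AKinv - gen (AQ 1) - gen (AQ (- 1)))) * gen (AQ 1)"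

definition higgs_to_aw_diff :: "complex \<Rightarrow> aw free_algebra"
  where "higgs_to_aw_diff q = scal (8 * (1 + q)) * gen AK3 * gen (AQ 1)"

text \<open>
  The inverse of \<open>aw_to_higgs\<close>: the formulas for \<open>K\<^sub>2\<close> and \<open>K\<^sub>3\<close> are solved for
  \<open>q\<inverse> M\<^sub>+ + q M\<^sub>-\<close> (\<open>higgs_to_aw_sum\<close>) and \<open>M\<^sub>+ - M\<^sub>-\<close> (\<open>higgs_to_aw_diff\<close>).
\<close>

definition higgs_to_aw :: "complex \<Rightarrow> higgs \<Rightarrow> aw free_algebra"
  where "higgs_to_aw q g = (case g of
      HMp \<Rightarrow> scal (q / (q\<^sup>2 + 1)) * (higgs_to_aw_sum q + scal q * higgs_to_aw_diff q)
    | HMm \<Rightarrow> scal (q / (q\<^sup>2 + 1)) * (higgs_to_aw_sum q - scal (1 / q) * higgs_to_aw_diff q)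
    | HX \<Rightarrow> aw_X q
    | HXinv \<Rightarrow> gen AKinv
    | HLL12 \<Rightarrow> scal ((1 + q)\<^sup>2) * gen AC1 - 1
    | HLL34 \<Rightarrow> scal ((1 + q)\<^sup>2) * gen AC2 - 1
    | HQ s \<Rightarrow> gen (AQ (2 * s)))"

lemma el_conjugation_inverse:
  assumes "el R x * el R m = cscale c (el R m * el R x)" "c \<noteq> 0"
    and "el R y * el R x = el R 1" "el R x * el R y = el R 1"
  shows "el R y * el R m = cscale (1 / c) (el R m * el R y)"
proof -
  have "el R m * el R y = el R y * (el R x * el R m) * el R y"
    using assms(3) by (simp add: el_1_mult flip: mult.assoc)
  also have "\<dots> = cscale c (el R y * el R m * (el R x * el R y))"
    by (simp add: assms(1) cscale_mult mult.assoc)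
  also have "\<dots> = cscale c (el R y * el R m)"
    by (simp add: assms(4) el_1_mult mult.assoc)
  finally show ?thesis
    using assms(2) by simp
qed

context deformation
begin

subsection \<open>The weight relations of the Higgs algebra\<close>

abbreviation "HH \<equiv> el (higgs_weight_rels q)"

lemma higgs_weight_rules:
  "HH (gen HX) * HH (gen HXinv) = HH 1"
  "HH (gen HXinv) * HH (gen HX) = HH 1"
  "HH (gen HX) * HH (gen HMp) = cscale (q\<^sup>2) (HH (gen HMp) * HH (gen HX))"
  "HH (gen HX) * HH (gen HMm) = cscale (1 / q\<^sup>2) (HH (gen HMm) * HH (gen HX))"
  "HH (gen HXinv) * HH (gen HMp) = cscale (1 / q\<^sup>2) (HH (gen HMp) * HH (gen HXinv))"
  "HH (gen HXinv) * HH (gen HMm) = cscale (q\<^sup>2) (HH (gen HMm) * HH (gen HXinv))"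
  "HH (gen (HQ s)) * HH (gen (HQ t)) = HH (gen (HQ (s + t)))"
  "HH (gen (HQ 0)) = HH 1"
proof -
  note rel = higgs_weight_relsI[where q = q, THEN el_rel]
  show 1: "HH (gen HX) * HH (gen HXinv) = HH 1" "HH (gen HXinv) * HH (gen HX) = HH 1"
    using rel(1,2) by (simp_all add: el_simps)
  show 2: "HH (gen HX) * HH (gen HMp) = cscale (q\<^sup>2) (HH (gen HMp) * HH (gen HX))"
    "HH (gen HX) * HH (gen HMm) = cscale (1 / q\<^sup>2) (HH (gen HMm) * HH (gen HX))"
    using rel(3,4) by (simp_all add: el_simps cscale_mult)
  show "HH (gen HXinv) * HH (gen HMp) = cscale (1 / q\<^sup>2) (HH (gen HMp) * HH (gen HXinv))"
    by (rule el_conjugation_inverse[OF 2(1) _ 1(2,1)]) (simp add: q_nonzero)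
  show "HH (gen HXinv) * HH (gen HMm) = cscale (q\<^sup>2) (HH (gen HMm) * HH (gen HXinv))"
    using el_conjugation_inverse[OF 2(2) _ 1(2,1)] by (simp add: q_nonzero)
  show "HH (gen (HQ s)) * HH (gen (HQ t)) = HH (gen (HQ (s + t)))"
    using rel(6)[of s t] by (simp add: el_simps)
  show "HH (gen (HQ 0)) = HH 1"
    using rel(5) by (simp add: el_simps)
qed

lemma higgs_central:
  "HH (gen g) * HH (gen HLL12) = HH (gen HLL12) * HH (gen g)"
  "HH (gen g) * HH (gen HLL34) = HH (gen HLL34) * HH (gen g)"
  "HH (gen g) * HH (gen (HQ s)) = HH (gen (HQ s)) * HH (gen g)"
  using higgs_weight_relsI(7,8,9)[where q = q and g = g, THEN el_rel] by (simp_all add: el_simps)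

lemmas higgs_central_rules = higgs_central[of HMp] higgs_central[of HMm] higgs_central[of HX]
  higgs_central[of HXinv] higgs_central(1)[of HLL34] higgs_central(1,2)[of "HQ t" for t]

lemmas HH_norm = subst_simps el_simps expand_simps higgs_weight_rules higgs_central_rules
  higgs_weight_rules(1-7)[THEN mult_eq_extend] higgs_central_rules[THEN mult_eq_extend]
  scalar_simps

text \<open>
  The structure constants enter the Askey--Wilson relations, rewritten in Higgs generators, only
  through the two central elements \<open>central_sum\<close> and \<open>central_diff\<close>.
\<close>

definition "qpole1 = 1 / (1 - q)"

text \<open>Once \<open>scaled_K2\<close> and \<open>scaled_K3\<close> have taken out the powers of
  1 + q, the coefficients of \<open>scaled_commutator\<close> have poles only at 0 and 1, and this
  smaller normal form suffices.\<close>

lemma qpole1_rules: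
  "q * qpole1 = qpole1 - 1" "q * (qpole1 * x) = qpole1 * x - x"
  "qinv * qpole1 = qinv + qpole1" "qinv * (qpole1 * x) = qinv * x + qpole1 * x"
proof -
  have "(1 - q) * qpole1 = 1"
    using q_nonzero by (simp add: qpole1_def)
  then show 1: "q * qpole1 = qpole1 - 1"
    by (simp add: algebra_simps)
  then show "q * (qpole1 * x) = qpole1 * x - x"
    by (simp add: left_diff_distrib flip: mult.assoc)
  have "q * (qinv * qpole1) = q * (qinv + qpole1)"
    by (simp add: 1 partial_fractions distrib_left)
  then show 2: "qinv * qpole1 = qinv + qpole1"
    using q_nonzero by simp
  then show "qinv * (qpole1 * x) = qinv * x + qpole1 * x"
    by (simp add: distrib_right flip: mult.assoc)
qed

lemma qpole1_eq: "qpole1 = (1 + q) * qpole"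
  using partial_fractions_divide(7)[of 1] by (simp add: qpole1_def)

text \<open>The central coefficient of q^(-L/2) in 2 (1 + q)^2 K_2 after the product of brackets is
  expanded; note (1 + q)^2 (1 + q^(-2)) / (q - 1/q)^2 = (1 + q^2) / (1 - q)^2.\<close>

definition "central_sum = (gen HLL12 + 1) * gen (HQ (1/2)) + (gen HLL34 + 1) * gen (HQ (- 1/2))
  - scal ((1 + q\<^sup>2) * qpole1\<^sup>2) * (gen (HQ (1/2)) + gen (HQ (- 1/2)))"

text \<open>This is (1 + q)^2 (C^(1) - C^(2)) (q^(H/2) - q^(-H/2)), which xi_5 contains.\<close>

definition "central_diff = (gen HLL12 - gen HLL34) * (gen (HQ (1/2)) - gen (HQ (- 1/2)))"

definition "scaled_K2 = central_sum * gen HXinv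
  + scal ((1 + q\<^sup>2) * qpole1\<^sup>2) * (1 + gen HXinv * gen HXinv)
  + (gen HMp + scal (q\<^sup>2) * gen HMm) * gen (HQ (- 1/2)) * gen HXinv"

definition "scaled_K3 = (gen HMp - gen HMm) * gen (HQ (- 1/2))"

text \<open>Centrality allows both elements to stay opaque letters that move to the left, which
  keeps the number of monomials in \<open>scaled_commutator\<close> small.\<close>

lemma central_sum_diff:
  "HH (gen g) * HH central_sum = HH central_sum * HH (gen g)"
  "HH (gen g) * HH central_diff = HH central_diff * HH (gen g)"
proof -
  have swap: "HH (gen g) * (HH (gen h) * z) = HH (gen h) * (HH (gen g) * z)"
    if "h \<in> {HLL12, HLL34} \<union> range HQ" for g h z
    using that higgs_central[of g] by (auto simp flip: mult.assoc)
  show "HH (gen g) * HH central_sum = HH central_sum * HH (gen g)"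
    "HH (gen g) * HH central_diff = HH central_diff * HH (gen g)"
    by (simp_all add: central_sum_def central_diff_def subst_simps el_simps
        expand_simps higgs_central[of g] swap)
qed

lemma central_diff_sum: "HH central_diff * HH central_sum = HH central_sum * HH central_diff"
  using el_commute_subst[of "higgs_weight_rels q" central_sum gen central_diff] central_sum_diff(1)
  by (simp add: subst_gen_id)

lemmas central_rules = central_sum_diff[of HMp] central_sum_diff[of HMm] central_sum_diff[of HX]
  central_sum_diff[of HXinv] central_sum_diff[of "HQ s" for s] central_diff_sum

lemmas HH_central_norm = HH_norm central_rules central_rules[THEN mult_eq_extend]

lemma HH_K1: "HH (aw_to_higgs q AK1) = cscale (qpole1 / 4) (HH 1 - HH (gen HX))"
  unfolding qpole1_eq
  by (rule eq_by_coords, simp only: aw_to_higgs.simps clear_denominators)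
    (simp add: HH_norm, simp add: coord_simps scalar_simps coefficient_simps)

lemma HH_K2: "HH (aw_to_higgs q AK2) = cscale (1 / (1 + q)\<^sup>2 / 2) (HH scaled_K2)"
  unfolding scaled_K2_def central_sum_def qpole1_eq
  by (rule eq_by_coords, simp only: aw_to_higgs.simps higgs_C1_def higgs_C2_def clear_denominators)
    (simp add: HH_norm, simp add: coord_simps scalar_simps, simp add: coefficient_simps)

lemma HH_K3: "HH (aw_to_higgs q AK3) = cscale (1 / (1 + q) / 8) (HH scaled_K3)"
  unfolding scaled_K3_def
  by (rule eq_by_coords, simp only: aw_to_higgs.simps clear_denominators)
    (simp add: HH_norm, simp add: coord_simps scalar_simps coefficient_simps)

lemma HH_xi7: "HH (subst (aw_to_higgs q) (aw_xi7 q)) =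
  cscale (qinv\<^sup>2 / 32) (HH central_sum + cscale (2 * ((1 + q\<^sup>2) * qpole1\<^sup>2)) (HH 1))"
  unfolding central_sum_def qpole1_eq
  by (rule eq_by_coords, simp only: aw_xi7_def subst_simps qbracket_def aw_to_higgs.simps higgs_C1_def
      higgs_C2_def clear_denominators)
    (simp add: HH_norm, simp add: coord_simps scalar_simps, simp add: coefficient_simps)

lemma HH_xi5: "HH (subst (aw_to_higgs q) ((gen AC1 - gen AC2) * qbracket q (\<lambda>s. gen (AQ s)))) =
  cscale (1 / (1 + q)\<^sup>2 * (1 / (q - qinv))) (HH central_diff)"
  by (rule eq_by_coords)
    (simp add: central_diff_def qbracket_def higgs_C1_def higgs_C2_def HH_norm,
      simp add: coord_simps scalar_simps, simp add: coefficient_simps)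

text \<open>The term with (q^(H/2) + q^(-H/2)) (q^(L/2) - q^(-L/2)) disappears into
  \<open>central_sum\<close> because 1 - (1 + q^2) / (1 - q)^2 = - 2 q / (1 - q)^2.\<close>

lemma HH_higgs_commutator_rel: "HH (higgs_commutator_rel q) =
  HH (gen HMp) * HH (gen HMm) - HH (gen HMm) * HH (gen HMp)
  - HH (gen (HQ 1)) * (cscale ((1 + q) * (1 + q\<^sup>2) * qinv\<^sup>2 * qpole1 ^ 3)
       (HH (gen HX) * HH (gen HX) - HH (gen HXinv) * HH (gen HXinv))
     + cscale ((1 + q) * qinv\<^sup>2 * qpole1)
       (HH central_sum * (HH (gen HX) - HH (gen HXinv)) - HH central_diff * HH (gen HX)))"
  unfolding central_sum_def central_diff_def qpole1_eq
  by (rule eq_by_coords, simp only: higgs_commutator_rel_def Let_def clear_denominators)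
    (simp add: HH_norm, simp add: coord_simps scalar_simps, simp add: coefficient_simps)

text \<open>The left-hand side is 16 (1 + q)^3 times the second Askey-Wilson relator, with K_1
  eliminated in favour of q^(L/2). The K_2^2 terms have cancelled, leaving K_2 q^(L/2) K_2 as the
  only quadratic term besides the commutator.\<close>

lemma scaled_commutator:
  "HH scaled_K2 * HH scaled_K3 - HH scaled_K3 * HH scaled_K2
    - cscale ((1 + q) * (1 - q) * qinv\<^sup>2) (HH scaled_K2 * HH (gen HX) * HH scaled_K2)
    - cscale ((1 + q\<^sup>2) * (1 + q) * qinv\<^sup>2 * qpole1)
        (cscale 2 (HH scaled_K2) - HH (gen HX) * HH scaled_K2 - HH scaled_K2 * HH (gen HX))
    + cscale ((1 + q) * (1 - q) * qinv\<^sup>2)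
        ((HH central_sum + cscale (2 * ((1 + q\<^sup>2) * qpole1\<^sup>2)) (HH 1)) * HH scaled_K2)
    - cscale ((1 + q\<^sup>2) * (1 + q) * qinv\<^sup>2 * qpole1) (HH central_diff)
  = cscale (- (1 + q\<^sup>2)) (HH (higgs_commutator_rel q) * HH (gen (HQ (- 1))) * HH (gen HXinv))"
  unfolding HH_higgs_commutator_rel
  by (rule eq_by_coords, simp only: scaled_K2_def scaled_K3_def el_simps)
    (simp add: HH_central_norm, simp add: coord_simps scalar_simps,
      simp add: partial_fractions(1,2) qpole1_rules power2_eq_square power3_eq_cube power4_eq_xxxx algebra_simps)

text \<open>
  The coefficient is invertible, so that the commutation relation of the Higgs algebra and the second
  Askey--Wilson relation imply each other.
\<close>

lemma HH_commutator:
  "HH (subst (aw_to_higgs q) (comm (gen AK2) (gen AK3) - aw_rhs2 q)) =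
    HH (scal (- ((q\<^sup>2 + 1) / (1 + q) ^ 3 / 16)) * higgs_commutator_rel q * gen (HQ (- 1)) * gen HXinv)"
proof -
  have rhs: "HH (scal (- ((q\<^sup>2 + 1) / (1 + q) ^ 3 / 16)) * higgs_commutator_rel q * gen (HQ (- 1)) * gen HXinv)
    = cscale (((1 - q) * qpole) ^ 3 / 16)
       (cscale (- (1 + q\<^sup>2)) (HH (higgs_commutator_rel q) * HH (gen (HQ (- 1))) * HH (gen HXinv)))"
    by (rule eq_by_coords) (simp add: el_simps cscale_mult scalar_simps coord_simps,
        simp add: algebra_simps add_divide_distrib)
  show ?thesis
    unfolding rhs scaled_commutator[symmetric]
    \<comment> \<open>The instance of \<open>mult.assoc\<close> groups C^(1) - C^(2) with the
      bracket, as \<open>HH_xi5\<close> expects; only scalars are then split off before that rule is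
      applied.\<close>
    by (rule eq_by_coords,
        simp only: scal_uminus[symmetric] subst_diff subst_comm subst_gen aw_rhs2_def subst_add subst_acomm
      mult.assoc[of _ "gen AC1 - gen AC2"],
        simp only: subst_mult[of _ "scal c" for c] subst_scal el_add el_diff el_scal_mult HH_xi5,
        simp only: subst_simps el_simps HH_K1 HH_K2 HH_K3 HH_xi7 clear_denominators,
        simp add: HH_central_norm,
        simp add: coord_simps scalar_simps,
        simp add: qpole1_eq coefficient_simps)
qed

subsection \<open>The special Askey--Wilson algebra\<close>

abbreviation "AW \<equiv> el (aw_rels q)"

lemma aw_central:
  "AW p * AW (gen AC1) = AW (gen AC1) * AW p"
  "AW p * AW (gen AC2) = AW (gen AC2) * AW p"
  "AW p * AW (gen (AQ s)) = AW (gen (AQ s)) * AW p"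
proof -
  have "AW (gen c) * AW (gen g) = AW (gen g) * AW (gen c)" if "c \<in> {AC1, AC2} \<union> range AQ" for c g
    using that aw_relsI(8,9,10)[where q = q and g = g, THEN el_rel] by (auto simp: el_simps)
  then have "AW (gen c) * AW (subst gen p) = AW (subst gen p) * AW (gen c)" if "c \<in> {AC1, AC2} \<union> range AQ" for c
    using that by (intro el_commute_subst) blast
  then show "AW p * AW (gen AC1) = AW (gen AC1) * AW p"
    "AW p * AW (gen AC2) = AW (gen AC2) * AW p"
    "AW p * AW (gen (AQ s)) = AW (gen (AQ s)) * AW p"
    by (simp_all add: subst_gen_id)
qed

text \<open>K_1 is affine in \<open>aw_X q\<close>, so it is eliminated, and the first and third
  relations become rules that move \<open>aw_X q\<close> to the right past K_2 and K_3.\<close>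

lemma aw_rules:
  "AW (aw_X q) * AW (gen AKinv) = AW 1"
  "AW (gen AKinv) * AW (aw_X q) = AW 1"
  "AW (aw_X q) * AW (gen AK2) = AW (gen AK2) * AW (aw_X q) - cscale (4 * (1 - q)) (AW (gen AK3))"
  "AW (aw_X q) * AW (gen AK3) = AW (gen AK3) * AW (aw_X q) + cscale (4 * (1 - q)) (AW (aw_rhs3 q))"
  "AW (gen (AQ s)) * AW (gen (AQ t)) = AW (gen (AQ (s + t)))"
  "AW (gen (AQ 0)) = AW 1"
  "AW (gen AK1) = cscale (qpole1 / 4) (AW 1 - AW (aw_X q))"
proof -
  note rel = aw_relsI[where q = q, THEN el_rel]
  show "AW (aw_X q) * AW (gen AKinv) = AW 1" "AW (gen AKinv) * AW (aw_X q) = AW 1"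
    using rel(4,5) by (simp_all add: el_simps)
  show "AW (aw_X q) * AW (gen AK2) = AW (gen AK2) * AW (aw_X q) - cscale (4 * (1 - q)) (AW (gen AK3))"
    "AW (aw_X q) * AW (gen AK3) = AW (gen AK3) * AW (aw_X q) + cscale (4 * (1 - q)) (AW (aw_rhs3 q))"
    using rel(1,3)
    by (simp_all add: aw_X_def el_simps expand_simps presented_prod.scale_right_diff_distrib eq_diff_eq
        flip: presented_prod.scale_right_distrib)
      (simp_all add: algebra_simps)
  show "AW (gen (AQ s)) * AW (gen (AQ t)) = AW (gen (AQ (s + t)))"
    using rel(7)[of s t] by (simp add: el_simps)
  show "AW (gen (AQ 0)) = AW 1"
    using rel(6) by (simp add: el_simps)
  have "cscale (qpole1 / 4) (AW 1 - AW (aw_X q)) = cscale (qpole1 / 4 * (4 * (1 - q))) (AW (gen AK1))"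
    by (simp only: aw_X_def el_simps) (simp add: el_simps cscale_mult)
  also have "qpole1 / 4 * (4 * (1 - q)) = 1"
    using q_nonzero by (simp add: qpole1_def)
  finally show "AW (gen AK1) = cscale (qpole1 / 4) (AW 1 - AW (aw_X q))"
    by simp
qed

lemmas aw_central_rules =
  aw_central[of "gen AK2"] aw_central[of "gen AK3"] aw_central[of "gen AKinv"] aw_central[of "aw_X q"]
  aw_central(1)[of "gen AC2"] aw_central(1,2)[of "gen (AQ s)" for s]

lemmas AW_norm = subst_simps el_simps expand_simps aw_rules aw_central_rules
  aw_rules(1-5)[THEN mult_eq_extend] aw_central_rules[THEN mult_eq_extend] scalar_simps

definition "qpole2 = 1 / (q\<^sup>2 + 1)"

text \<open>The denominator q^2 + 1 comes from solving for M_+ and M_-; (1 - q^2) + (q^2 + 1) = 2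
  separates the product of the two poles.\<close>

lemma qpole2_rules:
  "q * (q * qpole2) = 1 - qpole2" "q * (q * (qpole2 * x)) = x - qpole2 * x"
  "qinv * qpole2 = qinv - q * qpole2" "qinv * (qpole2 * x) = qinv * x - q * (qpole2 * x)"
  "qpole * qpole2 = qpole / 2 + qpole2 / 2" "qpole * (qpole2 * x) = qpole * x / 2 + qpole2 * x / 2"
  "c / (q\<^sup>2 + 1) = c * qpole2"
proof -
  have "(q\<^sup>2 + 1) * qpole2 = 1"
    using q_nonzero by (simp add: qpole2_def)
  then show 1: "q * (q * qpole2) = 1 - qpole2"
    by (simp add: algebra_simps power2_eq_square)
  then show "q * (q * (qpole2 * x)) = x - qpole2 * x"
    by (metis left_diff_distrib mult.assoc mult_1)
  have "q * (qinv * qpole2) = q * (qinv - q * qpole2)"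
    by (simp add: 1 partial_fractions right_diff_distrib)
  then show 2: "qinv * qpole2 = qinv - q * qpole2"
    using q_nonzero by simp
  then show "qinv * (qpole2 * x) = qinv * x - q * (qpole2 * x)"
    by (metis left_diff_distrib mult.assoc)
  have "qpole = qpole * ((q\<^sup>2 + 1) * qpole2)" "qpole2 = ((1 - q\<^sup>2) * qpole) * qpole2"
    using q_nonzero by (simp_all add: qpole2_def qpole_def)
  then have "qpole + qpole2 = qpole * ((q\<^sup>2 + 1) * qpole2) + ((1 - q\<^sup>2) * qpole) * qpole2"
    by (rule arg_cong2[where f = plus])
  then show 3: "qpole * qpole2 = qpole / 2 + qpole2 / 2"
    by (simp add: algebra_simps flip: add_divide_distrib)
  then show "qpole * (qpole2 * x) = qpole * x / 2 + qpole2 * x / 2"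
    by (simp add: distrib_right flip: mult.assoc)
  show "c / (q\<^sup>2 + 1) = c * qpole2"
    by (simp add: qpole2_def)
qed

lemmas higgs_to_aw_defs = higgs_to_aw_def higgs_to_aw_sum_def higgs_to_aw_diff_def

text \<open>These are the eigenvector equations. \<open>aw_rhs3\<close> stays folded while
  \<open>aw_X q\<close> moves past K_3 and is expanded only afterwards.\<close>

lemma AW_weight:
  "AW (aw_X q) * AW (higgs_to_aw q HMp) = cscale (q\<^sup>2) (AW (higgs_to_aw q HMp) * AW (aw_X q))"
  "AW (aw_X q) * AW (higgs_to_aw q HMm) = cscale (1 / q\<^sup>2) (AW (higgs_to_aw q HMm) * AW (aw_X q))"
  by (rule eq_by_coords, simp only: higgs_to_aw_defs higgs.case clear_denominators qpole2_rules(7),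
    simp add: AW_norm, simp only: aw_rhs3_def aw_xi7_def qbracket_def clear_denominators, simp add: AW_norm,
    simp add: coord_simps scalar_simps, simp add: qpole1_eq coefficient_simps qpole2_rules)+

lemma AW_inverse: "AW (subst (higgs_to_aw q) (aw_to_higgs q g)) = AW (gen g)"
proof (cases g)
  case AK1
  then show ?thesis
    by (intro eq_by_coords, simp only: aw_to_higgs.simps subst_simps higgs_to_aw_def higgs.case clear_denominators)
      (simp add: AW_norm qpole1_eq, simp add: coord_simps coefficient_simps)
next
  case AK2
  show ?thesis
    unfolding AK2
    by (rule eq_by_coords, simp only: aw_to_higgs.simps higgs_C1_def higgs_C2_def higgs_to_aw_defs higgs.case
        subst_simps clear_denominators qpole2_rules(7),
      simp add: AW_norm, simp add: coord_simps scalar_simps,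
      simp add: coefficient_simps qpole2_rules)
next
  case AK3
  show ?thesis
    unfolding AK3
    by (rule eq_by_coords, simp only: aw_to_higgs.simps higgs_to_aw_defs higgs.case
        subst_simps clear_denominators qpole2_rules(7),
      simp add: AW_norm, simp add: coord_simps scalar_simps,
      simp add: coefficient_simps qpole2_rules)
next
  case AKinv
  then show ?thesis
    by (simp add: higgs_to_aw_def subst_simps)
qed (use q_nonzero(4) in \<open>simp_all add: higgs_C1_def higgs_C2_def higgs_to_aw_def subst_simps el_simps expand_simps\<close>)

lemma HH_inverse: "HH (subst (aw_to_higgs q) (higgs_to_aw q g)) = HH (gen g)"
  by (rule eq_by_coords,
      cases g,
      simp_all only: aw_to_higgs.simps higgs_C1_def higgs_C2_def higgs_to_aw_defs higgs.case aw_X_def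
        subst_simps clear_denominators qpole2_rules(7),
      simp_all add: HH_norm,
      simp_all add: coord_simps scalar_simps,
      simp_all add: coefficient_simps qpole2_rules)

end

section \<open>The realization of the two algebras\<close>

context deformation
begin

lemma calJ_simps: "calJ q (1, g) = pair_realization q 1 2 g" "calJ q (2, g) = pair_realization q 3 4 g"
  by (simp_all add: calJ_def)

lemma calJ_respects:
  assumes "r \<in> tensor_rels {1, 2} (uq_rels q)"
  shows "EE (subst (calJ q) r) = 0"
proof (rule tensor_rels_respected[OF _ _ assms])
  show "EE (subst (\<lambda>g. calJ q (n, g)) r) = 0" if "n \<in> {1, 2}" "r \<in> uq_rels q" for n r
    using that pair_realization_respects[of 1 2 r] pair_realization_respects[of 3 4 r]
    by (auto simp: calJ_simps)
  show "EE (calJ q (n, g)) * EE (calJ q (m, h)) = EE (calJ q (m, h)) * EE (calJ q (n, g))"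
    if "n \<in> {1, 2}" "m \<in> {1, 2}" "n \<noteq> m" for n m g h
    using that pair_realization_commute[of 1 2 3 4] pair_realization_commute[of 3 4 1 2]
    by (auto simp: calJ_simps)
qed

lemma calC:
  "EE (calC1 q) = EE (scal (1 / (1 + q)\<^sup>2) * ((oscLL q 1 2)\<^sup>2 + 1))"
  "EE (calC2 q) = EE (scal (1 / (1 + q)\<^sup>2) * ((oscLL q 3 4)\<^sup>2 + 1))"
  using casimir_pair_realization[of 1 2] casimir_pair_realization[of 3 4]
  by (simp_all add: calC1_def calC2_def C1_def C2_def subst_subst subst_gen calJ_simps)

text \<open>For the structure constants this is the oscillator formula \<open>calC\<close> for the
  Casimir elements; the other generators agree by expanding the definitions.\<close>

lemma calJ_higgs_to_uq: "EE (subst (calJ q) (higgs_to_uq q g)) = EE (higgs_realization q g)"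
proof -
  have qq: "qpow q (1/2) * qpow q (- (1/2)) = 1"
    "qpow q (- (1/2)) * qpow q (1/2) = 1" "qpow q s * qpow q s = qpow q (2 * s)" for s
    using qpow_add[of s s] by (simp_all flip: qpow_add)
  show ?thesis
  proof (cases g)
    case HLL12
    then show ?thesis
      using calC(1) q_nonzero(4) by (simp add: higgs_to_uq_def subst_simps el_simps expand_simps flip: calC1_def)
  next
    case HLL34
    then show ?thesis
      using calC(2) q_nonzero(4) by (simp add: higgs_to_uq_def subst_simps el_simps expand_simps flip: calC2_def)
  qed (simp_all add: higgs_to_uq_def calJ_simps pair_realization_def oscMp_def oscMm_def qL_def qH_def
      subst_simps el_simps expand_simps two_sqrtq_nonzero power2_eq_square qq
      presented_prod.scale_right_distrib)
qed

text \<open>Transfers identities from the tensor square to oscillators, where no further computation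
  with four oscillators is required for K_1, K_2, K_3.\<close>

lemma realization_via_higgs:
  assumes "UU (subst (higgs_to_uq q) p') = UU p"
  shows "EE (subst (calJ q) p) = EE (subst (higgs_realization q) p')"
proof -
  have "EE (subst (calJ q) p) = EE (subst (calJ q) (subst (higgs_to_uq q) p'))"
    using assms[symmetric] by (rule el_subst_cong[rotated]) (rule calJ_respects)
  also have "\<dots> = EE (subst (higgs_realization q) p')"
    unfolding subst_subst by (rule el_subst_eqI) (rule calJ_higgs_to_uq)
  finally show ?thesis .
qed

lemma aw_realization_via_higgs: "EE (subst (higgs_realization q) (aw_to_higgs q g)) = EE (aw_realization q g)"
proof (cases g)
  case AK1
  then show ?thesis
    using realization_via_higgs[OF UU_K1] by (simp add: calK1_def)
next
  case AK2
  then show ?thesis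
    using realization_via_higgs[OF UU_K2] by (simp add: calK2_def)
next
  case AK3
  then show ?thesis
    using realization_via_higgs[OF UU_K3] by (simp add: calK3_def)
next
  case AKinv
  then show ?thesis
    using realization_via_higgs[OF UU_realizes_aw[of g]] by simp
next
  case AC1
  then show ?thesis
    using realization_via_higgs[OF UU_realizes_aw[of g]] by (simp add: calC1_def)
next
  case AC2
  then show ?thesis
    using realization_via_higgs[OF UU_realizes_aw[of g]] by (simp add: calC2_def)
next
  case (AQ s)
  then show ?thesis
    using realization_via_higgs[OF UU_realizes_aw[of g]] by simp
qed

lemma higgs_realization_respects:
  assumes "r \<in> higgs_rels q"
  shows "EE (subst (higgs_realization q) r) = 0"
proof -
  have "UU (subst (higgs_to_uq q) r) = UU 0"
    using assms UU_higgs_weight_rels UU_higgs_commutator_rel by (auto simp: higgs_rels_eq el_0)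
  \<comment> \<open>Each Higgs relator already vanishes in the tensor square, so the transfer
    applies with zero as the element there.\<close>
  from realization_via_higgs[OF this] show ?thesis
    by (simp add: subst_0 el_0)
qed

section \<open>Formulas for the realized generators\<close>

lemma cross_rules:
  "EE (gen (2, g)) * EE (gen (1, h)) = EE (gen (1, h)) * EE (gen (2, g))"
  "EE (gen (3, g)) * EE (gen (1, h)) = EE (gen (1, h)) * EE (gen (3, g))"
  "EE (gen (4, g)) * EE (gen (1, h)) = EE (gen (1, h)) * EE (gen (4, g))"
  "EE (gen (3, g)) * EE (gen (2, h)) = EE (gen (2, h)) * EE (gen (3, g))"
  "EE (gen (4, g)) * EE (gen (2, h)) = EE (gen (2, h)) * EE (gen (4, g))"
  "EE (gen (4, g)) * EE (gen (3, h)) = EE (gen (3, h)) * EE (gen (4, g))"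
  by (rule osc_cross; simp)+

lemmas EE4_norm = EE_norm cross_rules cross_rules[THEN mult_eq_extend]

lemma metaplectic4_eq: "metaplectic4 q (i, g) = metaplectic_at q (of_nat i) g"
  by (simp add: metaplectic4_def metaplectic_at_def)

lemma calJ_from_metaplectic:
  "EE (subst (metaplectic4 q) (coproduct 1 (gen g))) = EE (calJ q (1, g))"
  "EE (subst (\<lambda>(i, x). metaplectic4 q (i + 2, x)) (coproduct 1 (gen g))) = EE (calJ q (2, g))"
proof -
  have "subst (metaplectic4 q) (coproduct_gen 1 2 g) = subst (metaplectic_pair q 1 2) (coproduct_gen 1 2 g)"
    "subst (\<lambda>(i, x). metaplectic4 q (i + 2, x)) (coproduct_gen 1 2 g) = subst (metaplectic_pair q 3 4) (coproduct_gen 1 2 g)"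
    by (cases g; simp add: subst_simps metaplectic_pair_def metaplectic4_eq)+
  then show "EE (subst (metaplectic4 q) (coproduct 1 (gen g))) = EE (calJ q (1, g))"
    "EE (subst (\<lambda>(i, x). metaplectic4 q (i + 2, x)) (coproduct 1 (gen g))) = EE (calJ q (2, g))"
    using metaplectic_pair_coproduct[of 1 2 g] metaplectic_pair_coproduct[of 3 4 g]
    by (simp_all add: coproduct_1 subst_gen calJ_simps)
qed

text \<open>Coassociativity: the iterated coproduct always splits the last factor, whereas
  \<open>calJ\<close> splits both factors of a single coproduct. The two agree on generators, which
  suffices.\<close>

lemma coproduct_3_metaplectic:
  "EE (subst (metaplectic4 q) (coproduct 3 x)) = EE (subst (calJ q) (coproduct 1 x))"
proof -
  have "subst (metaplectic4 q) (coproduct 3 x) = subst (\<lambda>g. subst (metaplectic4 q) (coproduct 3 (gen g))) x"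
    by (simp add: numeral_3_eq_3 subst_subst subst_gen)
  moreover have "EE (subst (metaplectic4 q) (coproduct 3 (gen g))) = EE (subst (calJ q) (coproduct_gen 1 2 g))" for g
  proof -
    have c: "EE (subst (calJ q) (coproduct_gen 1 2 g)) =
        EE (subst (\<lambda>(i, g). subst (if i = 1 then metaplectic_pair q 1 2 else metaplectic_pair q 3 4)
          (coproduct_gen 1 2 g)) (coproduct_gen 1 2 g))"
      by (cases g) (simp_all add: subst_simps el_simps calJ_simps pair_realization_eq metaplectic_pair_coproduct[symmetric])
    show ?thesis
      unfolding c
      by (cases g) (simp_all add: numeral_3_eq_3 subst_simps metaplectic4_eq metaplectic_pair_def
          el_simps expand_simps add.assoc)
  qed
  then have "EE (subst (\<lambda>g. subst (metaplectic4 q) (coproduct 3 (gen g))) x) =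
      EE (subst (\<lambda>g. subst (calJ q) (coproduct_gen 1 2 g)) x)"
    by (rule el_subst_eqI)
  ultimately show ?thesis
    by (simp only: coproduct_1 subst_subst)
qed

text \<open>The sum of (L + H)/4 and (L - H)/4 is L/2 and their difference is H/2, so quarter powers
  disappear from the product.\<close>

lemma qbracket_product:
  "EE (qbracket q (\<lambda>s. qL (s/4) * qH q (s/4)) * qbracket q (\<lambda>s. qL (s/4) * qH q (- s/4))) =
   EE (scal (1 / (q - 1/q)\<^sup>2) * (qL (1/2) + qL (- 1/2) - qH q (1/2) - qH q (- 1/2)))"
  by (rule eq_by_coords,
      simp only: qbracket_def qL_def qH_def clear_denominators,
      simp add: EE4_norm osc_scalar_simps,
      simp add: coord_simps osc_scalar_simps,
      simp add: mult_ac power2_eq_square,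
      simp add: qroot_rules,
      simp only: mult_ac partial_fractions(1,2))

lemma calK2_casimir: "EE (calK2 q) = EE (scal (1/2) * subst (metaplectic4 q) (coproduct 3 (casimir q)))"
  by (simp add: calK2_def K2_def subst_simps el_simps coproduct_3_metaplectic)

lemma calK1_formula: "EE (calK1 q) = EE (scal (1/4 * (1 / (1 - q))) * (1 - qL (1/2)))"
  using realization_via_higgs[OF UU_K1] by (simp add: calK1_def subst_simps)

lemma calK2_formula: "EE (calK2 q) = EE (scal (1/2) *
  ((calC1 q * qH q (1/2) + calC2 q * qH q (- 1/2)) * qL (- 1/2)
   + scal (1 + 1 / q^2) * qL (- 1/2)
       * qbracket q (\<lambda>s. qL (s/4) * qH q (s/4)) * qbracket q (\<lambda>s. qL (s/4) * qH q (- s/4))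
   + scal (q / (1 + q)^2) * (scal (1 / q) * oscMp q + scal q * oscMm q)
       * (qH q (- 1/2) * qL (- 1/2))))"
proof -
  have C: "EE (calC1 q) = EE (subst (higgs_realization q) (higgs_C1 q))"
    "EE (calC2 q) = EE (subst (higgs_realization q) (higgs_C2 q))"
    by (simp_all only: calC higgs_C1_def higgs_C2_def subst_simps higgs_realization.simps)
  show ?thesis
    unfolding calK2_def realization_via_higgs[OF UU_K2]
    by (simp only: aw_to_higgs.simps subst_simps higgs_realization.simps el_scal_mult el_add
        el_mult mult.assoc C qbracket_product[unfolded el_mult])
qed

lemma calK3_formula: "EE (calK3 q) = EE (scal (1 / (8 * (1 + q))) * (oscMp q - oscMm q) * qH q (- 1/2))"
  using realization_via_higgs[OF UU_K3] by (simp add: calK3_def subst_simps)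

lemma osc_generators:
  "EE (oscMp q) = EE (scal ((two_sqrtq q)^2) * calJ q (1, Jp) * calJ q (2, Jm))"
  "EE (oscMm q) = EE (scal ((two_sqrtq q)^2) * calJ q (1, Jm) * calJ q (2, Jp))"
  using calJ_higgs_to_uq[of HMp] calJ_higgs_to_uq[of HMm]
  by (simp_all add: higgs_to_uq_def subst_simps)

lemma osc_L_H:
  "EE (scal (1/2) * oscL) = EE (calJ q (1, J0) - calJ q (2, J0))"
  "EE (scal (1/2) * oscH) = EE (calJ q (1, J0) + calJ q (2, J0))"
  by (rule eq_by_coords; simp add: calJ_simps pair_realization_def oscL_def oscH_def el_simps
      expand_simps coord_simps; simp add: algebra_simps add_divide_distrib)+

lemma osc_L_commute:
  "EE (comm oscL (oscMp q)) = EE (scal 4 * oscMp q)"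
  "EE (comm oscL (oscMm q)) = EE (- scal 4 * oscMm q)"
  by (rule eq_by_coords; simp add: oscL_def oscMp_def oscMm_def EE4_norm; simp add: coord_simps;
      simp add: algebra_simps)+

section \<open>The isomorphism\<close>

lemma HH_to_higgs: "HH x = HH y \<Longrightarrow> el (higgs_rels q) x = el (higgs_rels q) y"
  by (rule el_subset[of "higgs_weight_rels q"]) (auto simp: higgs_rels_eq)

lemma aw_to_higgs_respects:
  assumes "r \<in> aw_rels q"
  shows "el (higgs_rels q) (subst (aw_to_higgs q) r) = 0"
proof -
  have zero: "el (higgs_rels q) x = 0" if "HH x = 0" for x
    using HH_to_higgs[of x 0] that by (simp add: el_0)
  from assms show ?thesis
  proof (rule aw_rels_cases)
    let ?s = "\<lambda>r. el (higgs_rels q) (subst (aw_to_higgs q) r) = 0"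
    show "?s (comm (gen AK1) (gen AK2) - gen AK3)"
      by (rule zero, rule eq_by_coords,
          simp only: subst_simps el_simps HH_K1 HH_K2 HH_K3 scaled_K2_def scaled_K3_def qpole1_eq clear_denominators)
        (simp add: HH_central_norm, simp add: coord_simps scalar_simps, simp add: coefficient_simps)
    show "?s (comm (gen AK2) (gen AK3) - aw_rhs2 q)"
    proof -
      have "el (higgs_rels q) (higgs_commutator_rel q) = 0"
        by (rule el_rel) (simp add: higgs_rels_eq)
      then show ?thesis
        using HH_to_higgs[OF HH_commutator] by (simp add: el_mult)
    qed
    show "?s (comm (gen AK3) (gen AK1) - aw_rhs3 q)"
      by (rule zero, rule eq_by_coords, simp only: subst_simps el_simps aw_rhs3_def HH_K1 HH_K2 HH_K3 HH_xi7
          scaled_K2_def scaled_K3_def qpole1_eq clear_denominators)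
        (simp add: HH_central_norm, simp add: coord_simps scalar_simps, simp add: coefficient_simps)
    have X: "HH (subst (aw_to_higgs q) (aw_X q)) = HH (gen HX)"
      using HH_inverse[of HX] by (simp add: higgs_to_aw_def)
    show "?s (aw_X q * gen AKinv - 1)" "?s (gen AKinv * aw_X q - 1)"
      by (rule zero, simp add: subst_simps el_simps X higgs_weight_rules)+
    show "?s (gen (AQ 0) - 1)"
      by (rule zero) (simp add: subst_simps el_simps higgs_weight_rules)
    show "?s (gen (AQ s) * gen (AQ t) - gen (AQ (s + t)))" for s t
      by (rule zero) (simp add: subst_simps el_simps higgs_weight_rules add_divide_distrib)
    have central: "HH (gen HLL12) * HH p = HH p * HH (gen HLL12)"
      "HH (gen HLL34) * HH p = HH p * HH (gen HLL34)" "HH (gen (HQ s)) * HH p = HH p * HH (gen (HQ s))" for p s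
      using el_commute_subst[of "higgs_weight_rels q" _ gen p] higgs_central[symmetric]
      by (simp_all only: subst_gen_id)
    show "?s (comm (gen AC1) (gen g))" "?s (comm (gen AC2) (gen g))" "?s (comm (gen (AQ s)) (gen g))" for g s
      by (rule zero, simp add: higgs_C1_def higgs_C2_def subst_simps el_simps expand_simps central)+
  qed
qed

lemma higgs_to_aw_respects:
  assumes "r \<in> higgs_rels q"
  shows "AW (subst (higgs_to_aw q) r) = 0"
proof -
  have weight: "AW (subst (higgs_to_aw q) r) = 0" if "r \<in> higgs_weight_rels q" for r
    using that
  proof (rule higgs_weight_rels_cases)
    let ?s = "\<lambda>r. AW (subst (higgs_to_aw q) r) = 0"
    show "?s (gen HX * gen HXinv - 1)" "?s (gen HXinv * gen HX - 1)"
      by (simp_all add: higgs_to_aw_def subst_simps el_simps aw_rules)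
    show "?s (gen HX * gen HMp - scal (q^2) * gen HMp * gen HX)"
      "?s (gen HX * gen HMm - scal (1 / q^2) * gen HMm * gen HX)"
      using AW_weight by (simp_all add: higgs_to_aw_def[of _ HX] subst_simps el_simps cscale_mult)
    show "?s (gen (HQ 0) - 1)" "?s (gen (HQ s) * gen (HQ t) - gen (HQ (s + t)))" for s t
      by (simp_all add: higgs_to_aw_def subst_simps el_simps aw_rules distrib_left)
    show "?s (comm (gen HLL12) (gen g))" "?s (comm (gen HLL34) (gen g))" "?s (comm (gen (HQ s)) (gen g))" for g s
      by (simp_all add: higgs_to_aw_def[of _ HLL12] higgs_to_aw_def[of _ HLL34] higgs_to_aw_def[of _ "HQ s"]
          subst_simps el_simps expand_simps aw_central)
  qed
  show ?thesis
  proof (cases "r = higgs_commutator_rel q")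
    case True
    define c where "c = - ((q\<^sup>2 + 1) / (1 + q) ^ 3 / 16)"
    have c: "c \<noteq> 0"
      using q_nonzero by (simp add: c_def)
    \<comment> \<open>The proportionality is mapped to the Askey-Wilson algebra, which is legitimate
      because \<open>higgs_to_aw\<close> respects the weight relations; \<open>AW_inverse\<close>
      then gives back the original second relator.\<close>
    have "AW (subst (higgs_to_aw q) (scal c * higgs_commutator_rel q * gen (HQ (- 1)) * gen HXinv)) =
      AW (subst (higgs_to_aw q) (subst (aw_to_higgs q) (comm (gen AK2) (gen AK3) - aw_rhs2 q)))"
      unfolding c_def using HH_commutator[symmetric] weight by (rule el_subst_cong[rotated])
    also have "\<dots> = AW (comm (gen AK2) (gen AK3) - aw_rhs2 q)"
      unfolding subst_subst by (rule el_eq_subst_id) (rule AW_inverse)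
    also have "\<dots> = 0"
      by (rule el_rel) (rule aw_relsI)
    finally have "cscale c (AW (subst (higgs_to_aw q) r) * AW (gen (AQ (- 2))) * AW (gen AKinv)) = 0"
      by (simp add: True subst_simps el_simps expand_simps higgs_to_aw_def[of _ HXinv] higgs_to_aw_def[of _ "HQ (-1)"])
    \<comment> \<open>The images of q^(-L/2) and q^(-H) are units, cancelled on the right by
      \<open>aw_X q\<close> and \<open>AQ 2\<close>.\<close>
    then have "AW (subst (higgs_to_aw q) r) * AW (gen (AQ (- 2))) * AW (gen AKinv) * AW (aw_X q) * AW (gen (AQ 2)) = 0"
      using c by simp
    then show ?thesis
      by (simp add: mult.assoc aw_rules aw_rules(1-5)[THEN mult_eq_extend] el_1_mult el_1_mult_left)
  next
    case False
    then show ?thesis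
      using assms weight by (simp add: higgs_rels_eq)
  qed
qed

end

theorem mainTheorem3:
  fixes q :: complex
  assumes "0 < norm q" and "norm q < 1"
  shows "
    \<comment> \<open>\<open>calJ\<close> comes from the metaplectic representations by the coproduct\<close>
    (\<forall>g. subst (metaplectic4 q) (coproduct 1 (gen g)) \<approx>[q] calJ q (1, g)) \<and>
    (\<forall>g. subst (\<lambda>(i, x). metaplectic4 q (i + 2, x)) (coproduct 1 (gen g)) \<approx>[q] calJ q (2, g)) \<and>
    \<comment> \<open>and gives two mutually commuting realizations\<close>
    (\<forall>r \<in> tensor_rels {1, 2} (uq_rels q). subst (calJ q) r \<approx>[q] 0) \<and>
    \<comment> \<open>the realized generators\<close>
    (calK1 q \<approx>[q] scal (1/4 * (1 / (1 - q))) * (1 - qL (1/2))) \<and>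
    (calK2 q \<approx>[q] scal (1/2) * subst (metaplectic4 q) (coproduct 3 (casimir q))) \<and>
    (calK2 q \<approx>[q] scal (1/2) *
      ((calC1 q * qH q (1/2) + calC2 q * qH q (- 1/2)) * qL (- 1/2)
       + scal (1 + 1 / q^2) * qL (- 1/2)
           * qbracket q (\<lambda>s. qL (s/4) * qH q (s/4)) * qbracket q (\<lambda>s. qL (s/4) * qH q (- s/4))
       + scal (q / (1 + q)^2) * (scal (1 / q) * oscMp q + scal q * oscMm q)
           * (qH q (- 1/2) * qL (- 1/2)))) \<and>
    (calK3 q \<approx>[q] scal (1 / (8 * (1 + q))) * (oscMp q - oscMm q) * qH q (- 1/2)) \<and>
    (oscMp q \<approx>[q] scal ((two_sqrtq q)^2) * calJ q (1, Jp) * calJ q (2, Jm)) \<and>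
    (oscMm q \<approx>[q] scal ((two_sqrtq q)^2) * calJ q (1, Jm) * calJ q (2, Jp)) \<and>
    (scal (1/2) * oscL \<approx>[q] calJ q (1, J0) - calJ q (2, J0)) \<and>
    (scal (1/2) * oscH \<approx>[q] calJ q (1, J0) + calJ q (2, J0)) \<and>
    (comm oscL (oscMp q) \<approx>[q] scal 4 * oscMp q) \<and>
    (comm oscL (oscMm q) \<approx>[q] - scal 4 * oscMm q) \<and>
    \<comment> \<open>the images of the Casimir elements\<close>
    (calC1 q \<approx>[q] scal (1 / (1 + q)^2) * ((oscLL q 1 2)^2 + 1)) \<and>
    (calC2 q \<approx>[q] scal (1 / (1 + q)^2) * ((oscLL q 3 4)^2 + 1)) \<and>
    \<comment> \<open>the realized generators obey the respective relations, they are expressible in terms of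
      each other, and the two abstract algebras are isomorphic\<close>
    (\<exists>\<rho>\<^sub>A \<rho>\<^sub>H \<phi>.
       alg_hom_on_gens (aw_rels q) (osc4_rels q) (aw_realization q) \<rho>\<^sub>A
     \<and> alg_hom_on_gens (higgs_rels q) (osc4_rels q) (higgs_realization q) \<rho>\<^sub>H
     \<and> \<rho>\<^sub>A ` carrier (presented (aw_rels q)) = \<rho>\<^sub>H ` carrier (presented (higgs_rels q))
     \<and> alg_hom_on_gens (aw_rels q) (higgs_rels q) (aw_to_higgs q) \<phi>
     \<and> \<phi> \<in> ring_iso (presented (aw_rels q)) (presented (higgs_rels q))
     \<and> (\<forall>x \<in> carrier (presented (aw_rels q)). \<rho>\<^sub>H (\<phi> x) = \<rho>\<^sub>A x))"
proof -
  interpret deformation q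
    by standard (use assms in auto)
  obtain \<rho>\<^sub>H where H: "alg_hom_on_gens (higgs_rels q) (osc4_rels q) (higgs_realization q) \<rho>\<^sub>H"
    using alg_hom_exists[of "higgs_rels q"] higgs_realization_respects by blast
  obtain \<phi> where \<phi>: "alg_hom_on_gens (aw_rels q) (higgs_rels q) (aw_to_higgs q) \<phi>"
    using alg_hom_exists[of "aw_rels q"] aw_to_higgs_respects by blast
  \<comment> \<open>Choosing the Askey-Wilson realization as this composite makes the triangle
    commute by definition; existence of the homomorphism says that the realized K_1, K_2, K_3 obey
    the relations.\<close>
  have A: "alg_hom_on_gens (aw_rels q) (osc4_rels q) (aw_realization q) (\<rho>\<^sub>H \<circ> \<phi>)"
    using alg_hom_on_gens_comp[OF \<phi> H aw_realization_via_higgs] .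
  have iso: "\<phi> \<in> ring_iso (presented (aw_rels q)) (presented (higgs_rels q))"
    by (rule alg_hom_on_gens_iso[OF \<phi> higgs_to_aw_respects AW_inverse HH_to_higgs[OF HH_inverse]])
  then have "\<phi> ` carrier (presented (aw_rels q)) = carrier (presented (higgs_rels q))"
    by (simp add: ring_iso_def bij_betw_def)
  then have img: "(\<rho>\<^sub>H \<circ> \<phi>) ` carrier (presented (aw_rels q)) = \<rho>\<^sub>H ` carrier (presented (higgs_rels q))"
    by (metis image_comp)
  have homs: "\<exists>\<rho>\<^sub>A \<rho>\<^sub>H \<phi>.
       alg_hom_on_gens (aw_rels q) (osc4_rels q) (aw_realization q) \<rho>\<^sub>A
     \<and> alg_hom_on_gens (higgs_rels q) (osc4_rels q) (higgs_realization q) \<rho>\<^sub>H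
     \<and> \<rho>\<^sub>A ` carrier (presented (aw_rels q)) = \<rho>\<^sub>H ` carrier (presented (higgs_rels q))
     \<and> alg_hom_on_gens (aw_rels q) (higgs_rels q) (aw_to_higgs q) \<phi>
     \<and> \<phi> \<in> ring_iso (presented (aw_rels q)) (presented (higgs_rels q))
     \<and> (\<forall>x \<in> carrier (presented (aw_rels q)). \<rho>\<^sub>H (\<phi> x) = \<rho>\<^sub>A x)"
    using A H img \<phi> iso
    by (intro exI[of _ "\<rho>\<^sub>H \<circ> \<phi>"] exI[of _ \<rho>\<^sub>H] exI[of _ \<phi>] conjI ballI) (simp_all only: o_apply)
  have rels: "\<forall>r \<in> tensor_rels {1, 2} (uq_rels q). EE (subst (calJ q) r) = EE 0"
    using calJ_respects by (simp add: el_0)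
  show ?thesis
    unfolding el_eq_iff[symmetric]
    by (intro conjI allI homs rels calJ_from_metaplectic calK1_formula calK2_casimir calK2_formula
        calK3_formula osc_generators osc_L_H osc_L_commute calC)
qed

end
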